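(* In the graph-Gaussian setting described in the context, let $\mathcal{S}_k\subset\{1,\dots,M\}$ be the current observation set, let $i\in\{1,\dots,M\}\setminus\mathcal{S}_k$, and let $\boldsymbol{W}_k=\mathrm{diag}(w_{k,1},\dots,w_{k,M})\succeq 0$ be a fixed diagonal matrix. Let $$U_i(\mathcal{S}_k)=\mathrm{tr}\left(\boldsymbol{W}_k\boldsymbol{\Sigma}_{\mathcal{S}_k}\right)-\mathrm{tr}\left(\boldsymbol{W}_k\boldsymbol{\Sigma}_{\mathcal{S}_k\cup\{i\}}\right),$$ and define the posterior response vector and the prospective innovation $$\boldsymbol{u}_i=\frac{\boldsymbol{\Sigma}_{\mathcal{S}_k}\boldsymbol{e}_i}{\sigma_y^2+\Sigma_{\mathcal{S}_k,ii}},\qquad \nu_i=y_i-\boldsymbol{e}_i^{\mathsf{T}}\left(\widehat{\boldsymbol{x}}_{0|t}+\boldsymbol{m}_{\mathcal{S}_k,t}\right).$$ Then the change of the posterior mean induced by measuring $i$, namely $\Delta\widehat{\boldsymbol{x}}_i=\boldsymbol{m}_{\mathcal{S}_k\cup\{i\},t}-\boldsymbol{m}_{\mathcal{S}_k,t}$, satisfies $\Delta\widehat{\boldsymbol{x}}_i=\boldsymbol{u}_i\nu_i$, and $$U_i(\mathcal{S}_k)=\left(\sigma_y^2+\Sigma_{\mathcal{S}_k,ii}\right)\left\Vert\boldsymbol{u}_i\right\Vert_{\boldsymbol{W}_k}^2=\mathbb{E}\left[\left\Vert\Delta\widehat{\boldsymbol{x}}_i\right\Vert_{\boldsymbol{W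}_k}^2\,\middle|\,\mathcal{F}_k\right].$$
   Context: Setting. Let $\boldsymbol{C}_g=[c_{ij}]\in\mathbb{R}^{M\times M}$ be symmetric with nonnegative entries, $\boldsymbol{L}_g=\mathrm{diag}(\boldsymbol{C}_g\boldsymbol{1})-\boldsymbol{C}_g$, and $\boldsymbol{Q}_g=\tau\boldsymbol{I}+\lambda\boldsymbol{L}_g$ with $\tau>0$, $\lambda\ge 0$. A vector $\widehat{\boldsymbol{x}}_{0|t}\in\mathbb{R}^M$ is fixed, the residual $\boldsymbol{\delta}\in\mathbb{R}^M$ has prior law $\mathcal{N}(\boldsymbol{0},\boldsymbol{Q}_g^{-1})$, and the target is $\boldsymbol{x}_0=\widehat{\boldsymbol{x}}_{0|t}+\boldsymbol{\delta}$. Observations are noisy point observations: for an observation set $\mathcal{S}\subseteq\{1,\dots,M\}$, $\boldsymbol{y}_{\mathcal{S}}=\boldsymbol{H}_{\mathcal{S}}\boldsymbol{x}_0+\boldsymbol{\eta}_{\mathcal{S}}$, where the rows of $\boldsymbol{H}_{\mathcal{S}}$ are $\boldsymbol{e}_j^{\mathsf{T}}$, $j\in\mathcal{S}$ ($\boldsymbol{e}_j$ is the $j$th canonical basis vector of $\mathbb{R}^M$), and $\boldsymbol{\eta}_{\mathcal{S}}\sim\mathcal{N}(\boldsymbol{0},\boldsymbol{R}_{\mathcal{S}})$ with $\boldsymbol{R}_{\mathcal{S}}\succ0$ is independent of $\boldsymbol{\delta}$. The prospective measurement at $i\notin\mathcal{S}_k$ is $y_i=\boldsymbol{e}_i^{\mathsf{T}}\boldsymbol{x}_0+\eta_i$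 with $\eta_i\sim\mathcal{N}(0,\sigma_y^2)$, $\sigma_y^2>0$, and $\eta_i$ independent of $(\boldsymbol{\delta},\boldsymbol{\eta}_{\mathcal{S}_k})$; so $\boldsymbol{R}_{\mathcal{S}_k\cup\{i\}}$ is block diagonal with blocks $\boldsymbol{R}_{\mathcal{S}_k}$ and $\sigma_y^2$. Posterior quantities. For an observation set $\mathcal{S}$, let $\boldsymbol{A}_{\mathcal{S}}=\boldsymbol{Q}_g+\boldsymbol{H}_{\mathcal{S}}^{\mathsf{T}}\boldsymbol{R}_{\mathcal{S}}^{-1}\boldsymbol{H}_{\mathcal{S}}$, $\boldsymbol{\Sigma}_{\mathcal{S}}=\boldsymbol{A}_{\mathcal{S}}^{-1}$ (with entries $\Sigma_{\mathcal{S},jl}$), and $\boldsymbol{m}_{\mathcal{S},t}=\boldsymbol{A}_{\mathcal{S}}^{-1}\boldsymbol{H}_{\mathcal{S}}^{\mathsf{T}}\boldsymbol{R}_{\mathcal{S}}^{-1}(\boldsymbol{y}_{\mathcal{S}}-\boldsymbol{H}_{\mathcal{S}}\widehat{\boldsymbol{x}}_{0|t})$; these are the posterior covariance and mean of $\boldsymbol{\delta}$ given $\boldsymbol{y}_{\mathcal{S}}$ (for $\mathcal{S}=\varnothing$: $\boldsymbol{A}_\varnothing=\boldsymbol{Q}_g$, $\boldsymbol{m}_{\varnothing,t}=\boldsymbol{0}$). Conditioning on $\mathcal{F}_k$ means conditioning on everything known at round $k$: $\boldsymbol{C}_g$, $\widehat{\boldsymbol{x}}_{0|t}$, $\mathcal{S}_k$,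 $\boldsymbol{y}_{\mathcal{S}_k}$ and $\boldsymbol{W}_k$. Thus, given $\mathcal{F}_k$, under the model $\boldsymbol{\delta}\sim\mathcal{N}(\boldsymbol{m}_{\mathcal{S}_k,t},\boldsymbol{\Sigma}_{\mathcal{S}_k})$ and $\eta_i\sim\mathcal{N}(0,\sigma_y^2)$ independently of $\boldsymbol{\delta}$. For $\boldsymbol{B}\succeq0$, $\|\boldsymbol{v}\|_{\boldsymbol{B}}^2=\boldsymbol{v}^{\mathsf{T}}\boldsymbol{B}\boldsymbol{v}$. *)

theory Defs
  imports "HOL-Probability.Probability" "Jordan_Normal_Form.Gauss_Jordan_Elimination"
    "Jordan_Normal_Form.Determinant"
begin

hide_type (open) Finite_Cartesian_Product.vec
hide_const (open) Finite_Cartesian_Product.vec Finite_Cartesian_Product.row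
  Finite_Cartesian_Product.mat Determinants.det
unbundle no vec_syntax

section \<open>Matrices\<close>

text \<open>Coordinates are numbered from 0, so that the index set is \<open>{..<n}\<close>.\<close>

text \<open>The value is unspecified for singular matrices.\<close>

definition minv :: "real mat \<Rightarrow> real mat" where
  "minv A = the (mat_inverse A)"

definition mtrace :: "real mat \<Rightarrow> real" where
  "mtrace A = (\<Sum>j<dim_row A. A $$ (j, j))"

definition sym_mat :: "nat \<Rightarrow> real mat \<Rightarrow> bool" where
  "sym_mat n A \<longleftrightarrow> A \<in> carrier_mat n n \<and> transpose_mat A = A"

definition psd_mat :: "nat \<Rightarrow> real mat \<Rightarrow> bool" where
  "psd_mat n A \<longleftrightarrow> sym_mat n A \<and> (\<forall>v\<in>carrier_vec n. v \<bullet> (A *\<^sub>v v) \<ge> 0)"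

definition pd_mat :: "nat \<Rightarrow> real mat \<Rightarrow> bool" where
  "pd_mat n A \<longleftrightarrow> sym_mat n A \<and> (\<forall>v\<in>carrier_vec n. v \<noteq> 0\<^sub>v n \<longrightarrow> v \<bullet> (A *\<^sub>v v) > 0)"

definition wnorm2 :: "real mat \<Rightarrow> real vec \<Rightarrow> real" where
  "wnorm2 B v = v \<bullet> (B *\<^sub>v v)"


section \<open>Random vectors\<close>

text \<open>Borel sets of \<open>carrier_vec n\<close>, transported from the product space of the coordinates.\<close>

definition borel_vec :: "nat \<Rightarrow> real vec measure" where
  "borel_vec n = vimage_algebra (carrier_vec n) (\<lambda>v. \<lambda>j\<in>{..<n}. v $ j) (\<Pi>\<^sub>M j\<in>{..<n}. borel)"

definition lborel_vec :: "nat \<Rightarrow> real vec measure" where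
  "lborel_vec n = distr (\<Pi>\<^sub>M j\<in>{..<n}. lborel) (borel_vec n) (vec n)"

text \<open>Density of the Gaussian law with positive definite covariance \<open>S\<close>.  For \<open>n = 0\<close> the
  law is the unit mass at the empty vector.\<close>

definition gauss_density :: "nat \<Rightarrow> real vec \<Rightarrow> real mat \<Rightarrow> real vec \<Rightarrow> real" where
  "gauss_density n \<mu> S v =
     exp (- ((v - \<mu>) \<bullet> (minv S *\<^sub>v (v - \<mu>))) / 2) / sqrt ((2 * pi) ^ n * det S)"

definition gaussian_vec ::
  "'w measure \<Rightarrow> nat \<Rightarrow> ('w \<Rightarrow> real vec) \<Rightarrow> real vec \<Rightarrow> real mat \<Rightarrow> bool" where
  "gaussian_vec P n X \<mu> S \<longleftrightarrow>
     distributed P (lborel_vec n) X (\<lambda>v. ennreal (gauss_density n \<mu> S v))"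

text \<open>Independence of random variables that may take values in different types, which the
  library's \<open>indep_var\<close> does not allow.\<close>

definition indep_rv ::
  "'w measure \<Rightarrow> 'a measure \<Rightarrow> ('w \<Rightarrow> 'a) \<Rightarrow> 'b measure \<Rightarrow> ('w \<Rightarrow> 'b) \<Rightarrow> bool" where
  "indep_rv P A X B Y \<longleftrightarrow> X \<in> measurable P A \<and> Y \<in> measurable P B \<and>
     prob_space.indep_set P (sets (vimage_algebra (space P) X A))
       (sets (vimage_algebra (space P) Y B))"


section \<open>Graph prior and posterior\<close>

definition graph_laplacian :: "nat \<Rightarrow> real mat \<Rightarrow> real mat" where
  "graph_laplacian n C = mat_diag n (\<lambda>j. (C *\<^sub>v vec n (\<lambda>_. 1)) $ j) - C"

definition graph_precision :: "nat \<Rightarrow> real \<Rightarrow> real \<Rightarrow> real mat \<Rightarrow> real mat" where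
  "graph_precision n \<tau> lam C = \<tau> \<cdot>\<^sub>m 1\<^sub>m n + lam \<cdot>\<^sub>m graph_laplacian n C"

text \<open>An observation set is given through an enumeration \<open>js\<close> of its elements: the \<open>r\<close>-th row of
  the observation matrix is the unit vector of index \<open>js ! r\<close>, and noise, data and the noise
  covariance \<open>R\<close> are ordered in the same way.\<close>

definition obs_mat :: "nat \<Rightarrow> nat list \<Rightarrow> real mat" where
  "obs_mat n js = mat_of_rows n (map (unit_vec n) js)"

definition observe :: "nat \<Rightarrow> nat list \<Rightarrow> real vec \<Rightarrow> real vec \<Rightarrow> real vec" where
  "observe n js x \<eta> = obs_mat n js *\<^sub>v x + \<eta>"

definition post_precision :: "nat \<Rightarrow> real mat \<Rightarrow> nat list \<Rightarrow> real mat \<Rightarrow> real mat" where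
  "post_precision n Q js R = Q + transpose_mat (obs_mat n js) * minv R * obs_mat n js"

definition post_cov :: "nat \<Rightarrow> real mat \<Rightarrow> nat list \<Rightarrow> real mat \<Rightarrow> real mat" where
  "post_cov n Q js R = minv (post_precision n Q js R)"

definition post_mean ::
  "nat \<Rightarrow> real mat \<Rightarrow> nat list \<Rightarrow> real mat \<Rightarrow> real vec \<Rightarrow> real vec \<Rightarrow> real vec" where
  "post_mean n Q js R xhat y =
     (minv (post_precision n Q js R) * transpose_mat (obs_mat n js) * minv R)
       *\<^sub>v (y - obs_mat n js *\<^sub>v xhat)"

text \<open>Noise covariance after appending an independent scalar observation of noise variance \<open>s\<close>.\<close>

definition extend_cov :: "real mat \<Rightarrow> real \<Rightarrow> real mat" where
  "extend_cov R s =
     four_block_mat R (0\<^sub>m (dim_row R) 1) (0\<^sub>m 1 (dim_col R)) (mat 1 1 (\<lambda>_. s))"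

end

theory Submission
  imports Defs "HOL-Real_Asymp.Real_Asymp"
begin

text \<open>The mean and covariance formulas are the Sherman--Morrison identity: measuring coordinate \<open>i\<close> adds
  \<open>e\<^sub>i e\<^sub>i\<^sup>T / \<sigma>\<^sup>2\<close> to the posterior precision.  For the conditional expectation, completing the
  square in the joint density of prior and noise shows that the posterior error \<open>\<delta> - m\<close> is
  independent of the data and has density proportional to \<open>exp (- e\<^sup>T A e / 2)\<close>, with \<open>A\<close> the
  posterior precision.  The innovation is \<open>\<nu> = (\<delta> - m)\<^sub>i + \<eta>\<^sub>i\<close>, so its conditional second moment is
  the constant \<open>\<Sigma>\<^sub>i\<^sub>i + \<sigma>\<^sup>2\<close>.\<close>

text \<open>No multivariate Gaussian integral is evaluated. The densities carry normalising
  constants with determinants, and computing them would call for diagonalisation or a linear change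
  of variables. Instead each integral is compared with another one that carries the same unknown
  constant. The constant cancels, and the single fact needed about it, finiteness of the integral of
  the posterior kernel, follows from total mass one. Besides Tonelli's theorem, translation
  invariance is what is used of the Lebesgue measure on vectors: it performs the substitutions that
  separate error from data, and it yields a moment generating function, whose second difference at 0
  gives the variance. Conditioning is tested by nonnegative integrals against functions of the data,
  so integrability is a result and not a precondition. Inverse matrices are handled through their
  action on vectors: one solution formula for \<open>A' x = b + (t / s) e_i\<close> gives both the
  new mean (\<open>b\<close> from the old data, \<open>t\<close> the new datum) and the new
  covariance columns (\<open>b = e_j\<close>, \<open>t = 0\<close>).\<close>

unbundle no inner_syntax

section \<open>Positive definite matrices\<close>

lemma minv_eqI:
  assumes A: "A \<in> carrier_mat n n" and B: "B \<in> carrier_mat n n"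
    and AB: "A * B = 1\<^sub>m n" and BA: "B * A = 1\<^sub>m n"
  shows "minv A = B"
proof -
  have "A \<in> Units (ring_mat TYPE(real) n ())"
    using assms unfolding Units_def by (auto simp: ring_mat_simps)
  then obtain D where D: "mat_inverse A = Some D"
    using mat_inverse(1)[OF A, of "()"] by (cases "mat_inverse A") auto
  from mat_inverse(2)[OF A D] have "A * D = 1\<^sub>m n" and Dc: "D \<in> carrier_mat n n" by auto
  then have "B = B * (A * D)" using B by simp
  also have "\<dots> = D" using A B Dc BA by (simp flip: assoc_mult_mat)
  finally show ?thesis using D by (simp add: minv_def)
qed

lemma sym_mat_scalar_prod:
  assumes "sym_mat n A" "x \<in> carrier_vec n" "y \<in> carrier_vec n"
  shows "x \<bullet> (A *\<^sub>v y) = y \<bullet> (A *\<^sub>v x)"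
proof -
  have A: "A \<in> carrier_mat n n" "transpose_mat A = A" using assms(1) by (auto simp: sym_mat_def)
  have "y \<bullet> (A *\<^sub>v x) = (A *\<^sub>v x) \<bullet> y"
    using A assms by (intro comm_scalar_prod) auto
  also have "\<dots> = x \<bullet> (A *\<^sub>v y)"
    using transpose_vec_mult_scalar[OF A(1) assms(3,2)] A by simp
  finally show ?thesis by simp
qed

lemma pd_mat_carrier: "pd_mat n A \<Longrightarrow> A \<in> carrier_mat n n"
  by (simp add: pd_mat_def sym_mat_def)

text \<open>A nonzero kernel vector \<open>v\<close> would give \<open>v . A v = 0\<close>, so
  positive definiteness forces a nonzero determinant and \<open>mat_inverse\<close>
  succeeds.\<close>

lemma pd_mat_minv:
  assumes "pd_mat n A"
  shows "minv A \<in> carrier_mat n n" "A * minv A = 1\<^sub>m n" "minv A * A = 1\<^sub>m n"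
proof -
  have A: "A \<in> carrier_mat n n" using assms by (rule pd_mat_carrier)
  have "det A \<noteq> 0"
    using assms by (auto simp: det_0_iff_vec_prod_zero[OF A] pd_mat_def)
  then have "A \<in> Units (ring_mat TYPE(real) n ())"
    by (rule det_non_zero_imp_unit[OF A])
  then obtain D where D: "mat_inverse A = Some D"
    using mat_inverse(1)[OF A, of "()"] by (cases "mat_inverse A") auto
  from mat_inverse(2)[OF A D] D
  show "minv A \<in> carrier_mat n n" "A * minv A = 1\<^sub>m n" "minv A * A = 1\<^sub>m n"
    by (auto simp: minv_def)
qed

lemma pd_mat_minv_mult:
  assumes "pd_mat n A" "x \<in> carrier_vec n"
  shows "A *\<^sub>v (minv A *\<^sub>v x) = x" "minv A *\<^sub>v (A *\<^sub>v x) = x"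
  using pd_mat_minv[OF assms(1)] pd_mat_carrier[OF assms(1)] assms(2)
  by (simp_all flip: assoc_mult_mat_vec)

lemma minv_minv:
  assumes "pd_mat n A"
  shows "minv (minv A) = A"
  using pd_mat_minv[OF assms] pd_mat_carrier[OF assms] by (intro minv_eqI) auto

text \<open>Symmetry comes from uniqueness of the inverse, since the transpose is an inverse too;
  positivity from substituting \<open>v = A u\<close>, which turns the form of the inverse at
  \<open>v\<close> into that of \<open>A\<close> at \<open>u\<close>.\<close>

lemma pd_mat_minv_pd:
  assumes "pd_mat n A"
  shows "pd_mat n (minv A)"
proof -
  note A = pd_mat_carrier[OF assms] and B = pd_mat_minv[OF assms]
  have At: "transpose_mat A = A" using assms by (auto simp: pd_mat_def sym_mat_def)
  have "A * transpose_mat (minv A) = 1\<^sub>m n" "transpose_mat (minv A) * A = 1\<^sub>m n"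
    using transpose_mult[OF B(1) A] transpose_mult[OF A B(1)]
    unfolding B(2,3) At transpose_one by simp_all
  then have "minv A = transpose_mat (minv A)"
    using A B(1) by (intro minv_eqI) auto
  then have sym: "sym_mat n (minv A)" using B by (auto simp: sym_mat_def)
  have "v \<bullet> (minv A *\<^sub>v v) > 0" if v: "v \<in> carrier_vec n" "v \<noteq> 0\<^sub>v n" for v
  proof -
    let ?u = "minv A *\<^sub>v v"
    have u: "?u \<in> carrier_vec n" by (rule mult_mat_vec_carrier[OF B(1) v(1)])
    have Au: "A *\<^sub>v ?u = v" using pd_mat_minv_mult[OF assms v(1)] by simp
    have "?u \<noteq> 0\<^sub>v n"
    proof
      assume "?u = 0\<^sub>v n"
      moreover have "A *\<^sub>v 0\<^sub>v n = 0\<^sub>v n" using A by (intro eq_vecI) auto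
      ultimately show False using Au v(2) by simp
    qed
    then have "?u \<bullet> (A *\<^sub>v ?u) > 0" using assms u by (auto simp: pd_mat_def)
    then show ?thesis using Au comm_scalar_prod[OF u v(1)] by simp
  qed
  with sym show ?thesis by (auto simp: pd_mat_def)
qed

lemma pd_mat_sym: "pd_mat n A \<Longrightarrow> sym_mat n A"
  by (simp add: pd_mat_def)

lemma sym_matI:
  assumes "A \<in> carrier_mat n n" "\<And>a b. a < n \<Longrightarrow> b < n \<Longrightarrow> A $$ (a, b) = A $$ (b, a)"
  shows "sym_mat n A"
  using assms by (auto simp: sym_mat_def intro!: eq_matI)

lemma sym_matD:
  assumes "sym_mat n A" "a < n" "b < n"
  shows "A $$ (a, b) = A $$ (b, a)"
proof -
  have "A \<in> carrier_mat n n" "transpose_mat A = A" using assms(1) by (auto simp: sym_mat_def)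
  then have "transpose_mat A $$ (b, a) = A $$ (a, b)" using assms by (intro index_transpose_mat(1)) auto
  with \<open>transpose_mat A = A\<close> show ?thesis by simp
qed

lemma scalar_prod_mult_mat_vec:
  assumes "A \<in> carrier_mat n m" "x \<in> carrier_vec n" "y \<in> carrier_vec m"
  shows "x \<bullet> (A *\<^sub>v y) = (\<Sum>a<n. \<Sum>b<m. x $ a * A $$ (a, b) * y $ b)"
  using assms
  by (auto simp: scalar_prod_def sum_distrib_left atLeast0LessThan mult.assoc
      intro!: sum.cong)

lemma mult_unit_vec_index:
  fixes A :: "real mat"
  assumes "A \<in> carrier_mat m n" "a < m" "b < n"
  shows "(A *\<^sub>v unit_vec n b) $ a = A $$ (a, b)"
  using assms by (auto simp: scalar_prod_right_unit[where n = n])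

text \<open>The quadratic form equals \<tau> |v|^2 plus \<open>lam / 2\<close> times the Dirichlet
  energy, the sum of \<open>C_ab (v_a - v_b)^2\<close>. Nonnegative weights make the second term
  harmless, and \<tau> makes the first one strict.\<close>

lemma pd_mat_graph_precision:
  assumes C: "sym_mat n C" and nonneg: "\<And>a b. a < n \<Longrightarrow> b < n \<Longrightarrow> C $$ (a, b) \<ge> 0"
    and "\<tau> > 0" "lam \<ge> 0"
  shows "pd_mat n (graph_precision n \<tau> lam C)"
proof -
  have Cc: "C \<in> carrier_mat n n" using C by (simp add: sym_mat_def)
  let ?Q = "graph_precision n \<tau> lam C"
  have Q: "?Q \<in> carrier_mat n n"
    using Cc by (auto simp: graph_precision_def graph_laplacian_def mat_diag_def)
  have entry: "?Q $$ (a, b) = (if a = b then \<tau> + lam * (\<Sum>l<n. C $$ (a, l)) else 0) - lam * C $$ (a, b)"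
    if "a < n" "b < n" for a b
    using that Cc
    by (auto simp: graph_precision_def graph_laplacian_def mat_diag_def scalar_prod_def
        atLeast0LessThan algebra_simps)
  have sym: "sym_mat n ?Q"
    by (rule sym_matI[OF Q]) (simp add: entry sym_matD[OF C])
  have "v \<bullet> (?Q *\<^sub>v v) > 0" if v: "v \<in> carrier_vec n" "v \<noteq> 0\<^sub>v n" for v
  proof -
    let ?T = "\<lambda>a b. C $$ (a, b) * (v $ a)\<^sup>2"
    let ?X = "\<lambda>a b. C $$ (a, b) * (v $ a * v $ b)"
    have "v \<bullet> (?Q *\<^sub>v v) =
      (\<Sum>a<n. \<Sum>b<n. (if a = b then (v $ a)\<^sup>2 * (\<tau> + lam * (\<Sum>l<n. C $$ (a, l))) else 0) - lam * ?X a b)"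
      unfolding scalar_prod_mult_mat_vec[OF Q v(1) v(1)]
      by (intro sum.cong refl) (auto simp: entry algebra_simps power2_eq_square)
    also have "\<dots> = \<tau> * (\<Sum>a<n. (v $ a)\<^sup>2) + lam * ((\<Sum>a<n. \<Sum>b<n. ?T a b) - (\<Sum>a<n. \<Sum>b<n. ?X a b))"
      by (simp add: sum_subtractf sum.distrib sum_distrib_left algebra_simps)
    \<comment> \<open>By symmetry of \<open>C\<close> the degree term may be written with
      \<open>v_a^2\<close> or with \<open>v_b^2\<close>; averaging the two completes the square of
      \<open>v_a - v_b\<close>.\<close>
    also have "(\<Sum>a<n. \<Sum>b<n. ?T a b) - (\<Sum>a<n. \<Sum>b<n. ?X a b)
      = (\<Sum>a<n. \<Sum>b<n. C $$ (a, b) * (v $ a - v $ b)\<^sup>2) / 2"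
    proof -
      have "(\<Sum>a<n. \<Sum>b<n. ?T a b) = (\<Sum>b<n. \<Sum>a<n. ?T a b)" by (rule sum.swap)
      also have "\<dots> = (\<Sum>a<n. \<Sum>b<n. C $$ (a, b) * (v $ b)\<^sup>2)"
        by (intro sum.cong refl) (simp add: sym_matD[OF C])
      finally have "2 * ((\<Sum>a<n. \<Sum>b<n. ?T a b) - (\<Sum>a<n. \<Sum>b<n. ?X a b)) =
        (\<Sum>a<n. \<Sum>b<n. ?T a b) + (\<Sum>a<n. \<Sum>b<n. C $$ (a, b) * (v $ b)\<^sup>2) - 2 * (\<Sum>a<n. \<Sum>b<n. ?X a b)"
        by simp
      also have "\<dots> = (\<Sum>a<n. \<Sum>b<n. C $$ (a, b) * (v $ a - v $ b)\<^sup>2)"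
        by (simp add: sum_subtractf sum.distrib sum_distrib_left power2_diff algebra_simps)
      finally show ?thesis by simp
    qed
    also have "\<tau> * (\<Sum>a<n. (v $ a)\<^sup>2) + lam * ((\<Sum>a<n. \<Sum>b<n. C $$ (a, b) * (v $ a - v $ b)\<^sup>2) / 2) > 0"
    proof (rule add_pos_nonneg)
      obtain a where "a < n" "v $ a \<noteq> 0"
        using v by (auto simp: vec_eq_iff)
      then have "0 < (\<Sum>a<n. (v $ a)\<^sup>2)"
        by (intro sum_pos2[where i = a]) auto
      then show "0 < \<tau> * (\<Sum>a<n. (v $ a)\<^sup>2)" using \<open>\<tau> > 0\<close> by simp
      show "0 \<le> lam * ((\<Sum>a<n. \<Sum>b<n. C $$ (a, b) * (v $ a - v $ b)\<^sup>2) / 2)"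
        using \<open>lam \<ge> 0\<close> nonneg by (intro mult_nonneg_nonneg divide_nonneg_nonneg sum_nonneg) auto
    qed
    finally show ?thesis .
  qed
  with sym show ?thesis by (auto simp: pd_mat_def)
qed

section \<open>Posterior precision and rank-one updates\<close>

lemma obs_mat_carrier: "obs_mat n js \<in> carrier_mat (length js) n"
  using mat_of_rows_carrier(1)[of n "map (unit_vec n) js"] by (simp add: obs_mat_def)

lemma obs_mat_mult_vec:
  assumes "set js \<subseteq> {..<n}" "x \<in> carrier_vec n"
  shows "obs_mat n js *\<^sub>v x = vec (length js) (\<lambda>r. x $ (js ! r))"
  using assms by (intro eq_vecI) (auto simp: obs_mat_def subset_iff)

lemma obs_mat_append_mult_vec:
  assumes "set js \<subseteq> {..<n}" "i < n" "x \<in> carrier_vec n"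
  shows "obs_mat n (js @ [i]) *\<^sub>v x = (obs_mat n js *\<^sub>v x) @\<^sub>v vec 1 (\<lambda>_. x $ i)"
  using assms by (intro eq_vecI) (auto simp: obs_mat_mult_vec nth_append less_Suc_eq)

lemma transpose_obs_mat_append_mult_vec:
  assumes "i < n" "y \<in> carrier_vec (length js)"
  shows "transpose_mat (obs_mat n (js @ [i])) *\<^sub>v (y @\<^sub>v vec 1 (\<lambda>_. t))
    = transpose_mat (obs_mat n js) *\<^sub>v y + t \<cdot>\<^sub>v unit_vec n i" (is "?l = ?r")
proof (rule eq_vecI)
  fix j assume "j < dim_vec ?r"
  then have j: "j < n" by simp
  have row: "col (obs_mat n js') j $ r = (unit_vec n (js' ! r) :: real vec) $ j" if "r < length js'" for r js'
    using that j by (simp add: obs_mat_def mat_of_rows_index)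
  have d: "dim_vec y = length js" using assms by simp
  have "?l $ j = (\<Sum>r<Suc (length js). col (obs_mat n (js @ [i])) j $ r * (y @\<^sub>v vec 1 (\<lambda>_. t)) $ r)"
    using j d by (simp add: obs_mat_def scalar_prod_def atLeast0LessThan)
  also have "\<dots> = (\<Sum>r<length js. col (obs_mat n js) j $ r * y $ r) + unit_vec n i $ j * t"
    using j d by (simp add: row nth_append)
  also have "\<dots> = ?r $ j"
    using j d obs_mat_carrier[of n js] by (simp add: scalar_prod_def atLeast0LessThan)
  finally show "?l $ j = ?r $ j" .
qed (simp add: obs_mat_def)

text \<open>Prior precision, design matrix and noise covariance are kept abstract because the locale
  is interpreted twice: for the current observation set and for the one enlarged by
  \<open>i\<close>.\<close>

locale linear_model =
  fixes n k :: nat and Q H R :: "real mat"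
  assumes Q: "pd_mat n Q" and H: "H \<in> carrier_mat k n" and R: "pd_mat k R"
begin

definition precision :: "real mat" where
  "precision = Q + transpose_mat H * minv R * H"

text \<open>The Kalman gain: the posterior mean is \<open>gain\<close> applied to the data after
  subtracting the prediction from \<open>xhat\<close>.\<close>

definition gain :: "real mat" where
  "gain = minv precision * transpose_mat H * minv R"

lemma carriers [simp]:
  "Q \<in> carrier_mat n n" "H \<in> carrier_mat k n" "transpose_mat H \<in> carrier_mat n k" "R \<in> carrier_mat k k" "minv R \<in> carrier_mat k k"
  "precision \<in> carrier_mat n n"
  using H pd_mat_carrier[OF Q] pd_mat_carrier[OF R] pd_mat_minv[OF R]
  by (auto simp: precision_def)

lemma precision_mult_vec:
  assumes "x \<in> carrier_vec n"
  shows "precision *\<^sub>v x = Q *\<^sub>v x + transpose_mat H *\<^sub>v (minv R *\<^sub>v (H *\<^sub>v x))"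
proof -
  have [simp]: "H *\<^sub>v x \<in> carrier_vec k" using mult_mat_vec_carrier[OF carriers(2) assms] .
  show ?thesis unfolding precision_def using assms
    by (simp add: add_mult_distrib_mat_vec[where nr = n and nc = n]
        assoc_mult_mat_vec[where ?n\<^sub>1.0 = n and ?n\<^sub>2.0 = k and ?n\<^sub>3.0 = n]
        assoc_mult_mat_vec[where ?n\<^sub>1.0 = n and ?n\<^sub>2.0 = k and ?n\<^sub>3.0 = k]
        mult_carrier_mat[where nr = n and n = k and nc = k]
        mult_carrier_mat[where nr = n and n = k and nc = n])
qed

lemma transpose_scalar_prod:
  assumes "x \<in> carrier_vec n" "y \<in> carrier_vec k"
  shows "x \<bullet> (transpose_mat H *\<^sub>v y) = (H *\<^sub>v x) \<bullet> y"
proof -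
  have "x \<bullet> (transpose_mat H *\<^sub>v y) = (transpose_mat H *\<^sub>v y) \<bullet> x"
    using assms mult_mat_vec_carrier[OF carriers(3)] by (intro comm_scalar_prod[where n = n]) auto
  also have "\<dots> = y \<bullet> (H *\<^sub>v x)" using assms by (intro transpose_vec_mult_scalar[OF carriers(2)])
  also have "\<dots> = (H *\<^sub>v x) \<bullet> y" using assms carriers(2)
    by (intro comm_scalar_prod[where n = k] mult_mat_vec_carrier[OF carriers(2)])
  finally show ?thesis .
qed

text \<open>Moving the transpose across the scalar product splits the form into a prior part and a
  noise part; symmetry and positivity of \<open>precision\<close> are then inherited from
  \<open>Q\<close> and \<open>minv R\<close>.\<close>

lemma scalar_prod_precision:
  assumes "x \<in> carrier_vec n" "y \<in> carrier_vec n"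
  shows "x \<bullet> (precision *\<^sub>v y) = x \<bullet> (Q *\<^sub>v y) + (H *\<^sub>v x) \<bullet> (minv R *\<^sub>v (H *\<^sub>v y))"
proof -
  have Hy: "H *\<^sub>v y \<in> carrier_vec k" using assms by (intro mult_mat_vec_carrier[OF carriers(2)])
  then have c: "minv R *\<^sub>v (H *\<^sub>v y) \<in> carrier_vec k" by (intro mult_mat_vec_carrier[OF carriers(5)])
  have "transpose_mat H *\<^sub>v (minv R *\<^sub>v (H *\<^sub>v y)) \<in> carrier_vec n"
    using c by (intro mult_mat_vec_carrier[OF carriers(3)])
  moreover have "Q *\<^sub>v y \<in> carrier_vec n" using assms by (intro mult_mat_vec_carrier[OF carriers(1)])
  ultimately have "x \<bullet> (precision *\<^sub>v y) = x \<bullet> (Q *\<^sub>v y) + x \<bullet> (transpose_mat H *\<^sub>v (minv R *\<^sub>v (H *\<^sub>v y)))"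
    using assms by (simp add: precision_mult_vec scalar_prod_add_distrib[where n = n])
  then show ?thesis using transpose_scalar_prod[OF assms(1) c] by simp
qed

lemma pd_precision: "pd_mat n precision"
proof -
  let ?u = "\<lambda>a. unit_vec n a :: real vec"
  have entry: "precision $$ (a, b) = ?u a \<bullet> (precision *\<^sub>v ?u b)" if "a < n" "b < n" for a b
    using that carriers(6) by (simp add: mult_unit_vec_index[OF carriers(6)] scalar_prod_left_unit[where n = n] mult_mat_vec_carrier[OF carriers(6)])
  have "sym_mat n precision"
  proof (rule sym_matI[OF carriers(6)])
    fix a b assume ab: "a < n" "b < n"
    have c: "?u a \<in> carrier_vec n" "?u b \<in> carrier_vec n" "H *\<^sub>v ?u a \<in> carrier_vec k"
      "H *\<^sub>v ?u b \<in> carrier_vec k"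
      using mult_mat_vec_carrier[OF carriers(2)] by auto
    show "precision $$ (a, b) = precision $$ (b, a)"
      using ab c by (simp add: entry scalar_prod_precision sym_mat_scalar_prod[OF pd_mat_sym[OF Q], of "?u a"]
          sym_mat_scalar_prod[OF pd_mat_sym[OF pd_mat_minv_pd[OF R]], of "H *\<^sub>v ?u a"])
  qed
  moreover have "v \<bullet> (precision *\<^sub>v v) > 0" if v: "v \<in> carrier_vec n" "v \<noteq> 0\<^sub>v n" for v
  proof -
    have Hv: "H *\<^sub>v v \<in> carrier_vec k" using mult_mat_vec_carrier[OF carriers(2) v(1)] .
    have "v \<bullet> (Q *\<^sub>v v) > 0" using Q v by (auto simp: pd_mat_def)
    moreover have "(H *\<^sub>v v) \<bullet> (minv R *\<^sub>v (H *\<^sub>v v)) \<ge> 0"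
    \<comment> \<open>A nonzero \<open>v\<close> may be invisible to the observations, and
      \<open>pd_mat\<close> speaks of nonzero vectors only.\<close>
    proof (cases "H *\<^sub>v v = 0\<^sub>v k")
      case True
      then show ?thesis
        using scalar_prod_left_zero[OF mult_mat_vec_carrier[OF carriers(5) Hv]] by simp
    next
      case False
      then show ?thesis using pd_mat_minv_pd[OF R] Hv by (auto simp: pd_mat_def less_imp_le)
    qed
    ultimately show ?thesis using v by (simp add: scalar_prod_precision)
  qed
  ultimately show ?thesis by (auto simp: pd_mat_def)
qed

end

section \<open>Rank-one updates of the precision (Sherman--Morrison)\<close>

locale rank_one_update =
  fixes n :: nat and A A' :: "real mat" and i :: nat and s :: real
  assumes A: "pd_mat n A" and A': "pd_mat n A'" and i: "i < n" and s: "s > 0"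
    and update: "\<And>x. x \<in> carrier_vec n \<Longrightarrow> A' *\<^sub>v x = A *\<^sub>v x + (x $ i / s) \<cdot>\<^sub>v unit_vec n i"
begin

definition response :: "real vec" where
  "response = (1 / (s + minv A $$ (i, i))) \<cdot>\<^sub>v (minv A *\<^sub>v unit_vec n i)"

lemma carriers [simp]:
  "A \<in> carrier_mat n n" "A' \<in> carrier_mat n n" "minv A \<in> carrier_mat n n" "minv A' \<in> carrier_mat n n"
  "response \<in> carrier_vec n"
  using pd_mat_carrier[OF A] pd_mat_carrier[OF A'] pd_mat_minv[OF A] pd_mat_minv[OF A']
  by (auto simp: response_def mult_mat_vec_carrier[where n = n])

lemma dims [simp]:
  "dim_row A = n" "dim_col A = n" "dim_row (minv A) = n" "dim_col (minv A) = n" "dim_vec response = n"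
  by (rule carrier_matD[OF carriers(1)] carrier_matD[OF carriers(3)] carrier_vecD[OF carriers(5)])+

lemma diag_pos: "minv A $$ (i, i) > 0"
proof -
  have "unit_vec n i \<bullet> (minv A *\<^sub>v unit_vec n i) > 0"
    using pd_mat_minv_pd[OF A] i by (auto simp: pd_mat_def)
  then show ?thesis using i carriers(3)
    by (simp add: scalar_prod_left_unit[where n = n] mult_mat_vec_carrier[where n = n and nr = n]
        mult_unit_vec_index[OF carriers(3)])
qed

lemma response_index:
  assumes "j < n"
  shows "response $ j = minv A $$ (i, j) / (s + minv A $$ (i, i))"
  using assms i carriers(3) sym_matD[OF pd_mat_sym[OF pd_mat_minv_pd[OF A]], of i j]
  by (simp add: response_def mult_unit_vec_index[OF carriers(3)] del: index_mult_mat_vec)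

lemma mult_response: "A *\<^sub>v response = (1 / (s + minv A $$ (i, i))) \<cdot>\<^sub>v unit_vec n i"
  using pd_mat_minv_mult(1)[OF A, of "unit_vec n i"] carriers(1,3)
  by (simp add: response_def mult_mat_vec[where nr = n and nc = n] mult_mat_vec_carrier[where n = n and nr = n])

text \<open>The right-hand side is verified as a solution: \<open>A'\<close> is applied to it, using
  that \<open>A\<close> maps \<open>response\<close> to a multiple of \<open>e_i\<close>, and then
  \<open>minv A'\<close> undoes this. Comparing coefficients of \<open>e_i\<close> is the only
  computation. Here \<open>t\<close> plays the role of the new datum and its difference from the old
  prediction is the innovation.\<close>

lemma minv_update:
  assumes b: "b \<in> carrier_vec n"
  shows "minv A' *\<^sub>v (b + (t / s) \<cdot>\<^sub>v unit_vec n i)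
    = minv A *\<^sub>v b + (t - (minv A *\<^sub>v b) $ i) \<cdot>\<^sub>v response" (is "_ = ?m + ?\<nu> \<cdot>\<^sub>v _")
proof -
  have m: "?m \<in> carrier_vec n" using b by (intro mult_mat_vec_carrier[OF carriers(3)])
  have pos: "s + minv A $$ (i, i) > 0" using s diag_pos by simp
  have Am: "A *\<^sub>v ?m = b" using pd_mat_minv_mult(1)[OF A b] .
  have x: "?m + ?\<nu> \<cdot>\<^sub>v response \<in> carrier_vec n" using m by simp
  have "A *\<^sub>v (?m + ?\<nu> \<cdot>\<^sub>v response) = b + ?\<nu> \<cdot>\<^sub>v ((1 / (s + minv A $$ (i, i))) \<cdot>\<^sub>v unit_vec n i)"
    using m by (simp add: mult_add_distrib_mat_vec[OF carriers(1)] mult_mat_vec[OF carriers(1)]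
        mult_response Am del: index_mult_mat_vec)
  then have "A' *\<^sub>v (?m + ?\<nu> \<cdot>\<^sub>v response) =
    b + ?\<nu> \<cdot>\<^sub>v ((1 / (s + minv A $$ (i, i))) \<cdot>\<^sub>v unit_vec n i)
      + ((?m + ?\<nu> \<cdot>\<^sub>v response) $ i / s) \<cdot>\<^sub>v unit_vec n i"
    by (simp only: update[OF x])
  also have "\<dots> = b + (t / s) \<cdot>\<^sub>v unit_vec n i"
  proof -
    have "?\<nu> * (1 / (s + minv A $$ (i, i))) + (?m + ?\<nu> \<cdot>\<^sub>v response) $ i / s = t / s"
    proof -
      \<comment> \<open>\<open>a\<close> stands for the prediction of coordinate \<open>i\<close>,
        \<open>q\<close> for the innovation variance \<open>s + minv A $$ (i, i)\<close>, so
        \<open>(q - s) / q\<close> is \<open>response $ i\<close>.\<close>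
      have *: "(t - a) * (1 / q) + (a + (t - a) * ((q - s) / q)) / s = t / s" if "q > 0" for a q
        using that s by (simp add: field_simps)
      show ?thesis
        using m i *[OF pos, of "?m $ i"] by (simp add: response_index del: index_mult_mat_vec)
    qed
    then show ?thesis using b i
      by (intro eq_vecI) (auto simp: algebra_simps simp del: index_mult_mat_vec)
  qed
  finally have eq: "A' *\<^sub>v (?m + ?\<nu> \<cdot>\<^sub>v response) = b + (t / s) \<cdot>\<^sub>v unit_vec n i" .
  from pd_mat_minv_mult(2)[OF A' x] show ?thesis by (simp add: eq)
qed

text \<open>Column \<open>j\<close> of the new inverse is \<open>minv_update\<close> with
  \<open>b = e_j\<close> and datum \<open>t = 0\<close>. Its correction is the (i, j) entry times
  \<open>response\<close>, and that entry is itself \<open>s + minv A $$ (i, i)\<close> times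
  \<open>response $ j\<close>, whence the square.\<close>

lemma minv_update_diag:
  assumes j: "j < n"
  shows "minv A' $$ (j, j) = minv A $$ (j, j) - (s + minv A $$ (i, i)) * (response $ j)\<^sup>2"
proof -
  have pos: "s + minv A $$ (i, i) > 0" using s diag_pos by simp
  have e: "(unit_vec n j :: real vec) + (0 / s) \<cdot>\<^sub>v unit_vec n i = unit_vec n j" by (intro eq_vecI) auto
  have "minv A' $$ (j, j) = (minv A' *\<^sub>v unit_vec n j) $ j"
    using mult_unit_vec_index[OF carriers(4) j j] by simp
  also have "\<dots> = (minv A *\<^sub>v unit_vec n j + (0 - (minv A *\<^sub>v unit_vec n j) $ i) \<cdot>\<^sub>v response) $ j"
    using minv_update[of "unit_vec n j" 0] e by simp
  also have "\<dots> = minv A $$ (j, j) - minv A $$ (i, j) * response $ j"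
    using j i carriers(3,5)
    by (simp add: mult_unit_vec_index[OF carriers(3)] del: index_mult_mat_vec)
  also have "minv A $$ (i, j) = (s + minv A $$ (i, i)) * response $ j"
    using j pos by (simp add: response_index)
  finally show ?thesis by (simp add: power2_eq_square)
qed

text \<open>A diagonal weight sees only the diagonal of the covariance, so the diagonal update
  formula suffices.\<close>

lemma mtrace_update:
  "mtrace (mat_diag n w * minv A) - mtrace (mat_diag n w * minv A')
    = (s + minv A $$ (i, i)) * wnorm2 (mat_diag n w) response"
proof -
  have tr: "mtrace (mat_diag n w * B) = (\<Sum>j<n. w j * B $$ (j, j))" if "B \<in> carrier_mat n n" for B
    using that by (simp add: mtrace_def mat_diag_mult_left)
  have "wnorm2 (mat_diag n w) response = (\<Sum>j<n. w j * (response $ j)\<^sup>2)"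
    unfolding wnorm2_def scalar_prod_mult_mat_vec[OF mat_diag_dim carriers(5) carriers(5)]
    by (intro sum.cong refl) (auto simp: mat_diag_def power2_eq_square if_distrib if_distribR cong: if_cong)
  then show ?thesis
    by (simp add: tr minv_update_diag sum_subtractf[symmetric] sum_distrib_left algebra_simps)
qed

end

text \<open>The matrix is block diagonal, so its quadratic form is a sum over the two blocks and its
  inverse acts blockwise. The inverse is identified by applying \<open>extend_cov R s\<close> to the
  claimed image.\<close>

lemma minv_extend_cov:
  assumes R: "pd_mat k R" and s: "s > 0"
  shows "pd_mat (Suc k) (extend_cov R s)"
    and "x \<in> carrier_vec k \<Longrightarrow>
      minv (extend_cov R s) *\<^sub>v (x @\<^sub>v vec 1 (\<lambda>_. t)) = (minv R *\<^sub>v x) @\<^sub>v vec 1 (\<lambda>_. t / s)"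
proof -
  note Rc = pd_mat_carrier[OF R] and Ri = pd_mat_minv[OF R]
  let ?s = "mat 1 1 (\<lambda>_. s)"
  have ec: "extend_cov R s = four_block_mat R (0\<^sub>m k 1) (0\<^sub>m 1 k) ?s"
    using Rc by (simp add: extend_cov_def)
  have mult: "extend_cov R s *\<^sub>v (x @\<^sub>v y) = (R *\<^sub>v x) @\<^sub>v (?s *\<^sub>v y)"
    if "x \<in> carrier_vec k" "y \<in> carrier_vec 1" for x y
    unfolding ec using that by (intro mult_mat_vec_split[OF Rc]) auto
  have E: "extend_cov R s \<in> carrier_mat (Suc k) (Suc k)"
    using four_block_carrier_mat[OF Rc, of ?s 1 1] by (simp add: ec)
  have sym: "sym_mat (Suc k) (extend_cov R s)"
    using Rc sym_matD[OF pd_mat_sym[OF R]]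
    by (intro sym_matI[OF E]) (auto simp: ec)
  have "v \<bullet> (extend_cov R s *\<^sub>v v) > 0" if v: "v \<in> carrier_vec (Suc k)" "v \<noteq> 0\<^sub>v (Suc k)" for v
  proof -
    define x where "x = vec_first v k"
    define y where "y = vec_last v 1"
    have x: "x \<in> carrier_vec k" and y: "y \<in> carrier_vec 1" by (auto simp: x_def y_def)
    have vxy: "v = x @\<^sub>v y" using v vec_first_last_append[of v k 1] by (simp add: x_def y_def)
    have sy: "?s *\<^sub>v y \<in> carrier_vec 1" by (intro mult_mat_vec_carrier[OF _ y]) simp
    have "y \<bullet> (?s *\<^sub>v y) = s * (y $ 0)\<^sup>2"
      using y by (simp add: scalar_prod_mult_mat_vec[where n = 1 and m = 1] power2_eq_square)
    then have eq: "v \<bullet> (extend_cov R s *\<^sub>v v) = x \<bullet> (R *\<^sub>v x) + s * (y $ 0)\<^sup>2"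
      unfolding vxy mult[OF x y] scalar_prod_append[OF x y mult_mat_vec_carrier[OF Rc x] sy] by simp
    \<comment> \<open>When the first block of \<open>v\<close> vanishes, strict positivity has to
      come from the last coordinate.\<close>
    show ?thesis
    proof (cases "x = 0\<^sub>v k")
      case True
      have "y $ 0 \<noteq> 0"
      proof
        assume "y $ 0 = 0"
        then have "y = 0\<^sub>v 1" using y by (intro eq_vecI) auto
        then have "x @\<^sub>v y = 0\<^sub>v (Suc k)" using True by (intro eq_vecI) auto
        then show False using v(2) vxy by simp
      qed
      moreover have "x \<bullet> (R *\<^sub>v x) = 0"
        unfolding True by (rule scalar_prod_left_zero) (rule mult_mat_vec_carrier[OF Rc], simp)
      ultimately show ?thesis unfolding eq using s by simp
    next
      case False
      then have "x \<bullet> (R *\<^sub>v x) > 0" using R x by (auto simp: pd_mat_def)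
      then show ?thesis unfolding eq using s by (simp add: add_pos_nonneg)
    qed
  qed
  with sym show pd: "pd_mat (Suc k) (extend_cov R s)" by (auto simp: pd_mat_def)
  assume x: "x \<in> carrier_vec k"
  then have Rx: "minv R *\<^sub>v x \<in> carrier_vec k" by (intro mult_mat_vec_carrier[OF Ri(1)])
  have "?s *\<^sub>v vec 1 (\<lambda>_. t / s) = vec 1 (\<lambda>_. t)"
    using s by (intro eq_vecI) (auto simp: scalar_prod_def)
  then have "extend_cov R s *\<^sub>v ((minv R *\<^sub>v x) @\<^sub>v vec 1 (\<lambda>_. t / s)) = x @\<^sub>v vec 1 (\<lambda>_. t)"
    using Rx pd_mat_minv_mult(1)[OF R x] by (simp add: mult)
  then show "minv (extend_cov R s) *\<^sub>v (x @\<^sub>v vec 1 (\<lambda>_. t)) = (minv R *\<^sub>v x) @\<^sub>v vec 1 (\<lambda>_. t / s)"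
    using pd_mat_minv_mult(2)[OF pd, of "(minv R *\<^sub>v x) @\<^sub>v vec 1 (\<lambda>_. t / s)"] Rx
    by (metis append_carrier_vec vec_carrier add.commute plus_1_eq_Suc)
qed

section \<open>Lebesgue measure on vectors\<close>

lemma space_borel_vec [simp]: "space (borel_vec n) = carrier_vec n"
  by (simp add: borel_vec_def)

lemma sets_lborel_vec [measurable_cong, simp]: "sets (lborel_vec n) = sets (borel_vec n)"
  by (simp add: lborel_vec_def)

lemma space_lborel_vec [simp]: "space (lborel_vec n) = carrier_vec n"
  by (simp add: lborel_vec_def)

lemma borel_measurable_vec_index [measurable]:
  assumes "j < n"
  shows "(\<lambda>v. v $ j) \<in> borel_measurable (borel_vec n)"
proof -
  have "(\<lambda>v. \<lambda>j\<in>{..<n}. v $ j) \<in> borel_vec n \<rightarrow>\<^sub>M (\<Pi>\<^sub>M j\<in>{..<n}. borel)"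
    unfolding borel_vec_def by (rule measurable_vimage_algebra1) (auto simp: space_PiM)
  from measurable_compose[OF this measurable_component_singleton[of j]] assms
  show ?thesis by simp
qed

lemma measurable_borel_vecI:
  assumes "\<And>x. x \<in> space N \<Longrightarrow> f x \<in> carrier_vec n"
    and "\<And>j. j < n \<Longrightarrow> (\<lambda>x. f x $ j) \<in> borel_measurable N"
  shows "f \<in> N \<rightarrow>\<^sub>M borel_vec n"
  unfolding borel_vec_def using assms
  by (intro measurable_vimage_algebra2 measurable_restrict) auto

lemma measurable_borel_vec_index:
  assumes "f \<in> N \<rightarrow>\<^sub>M borel_vec n" "j < n"
  shows "(\<lambda>x. f x $ j) \<in> borel_measurable N"
  using measurable_compose[OF assms(1) borel_measurable_vec_index[OF assms(2)]] .

lemma measurable_vec_carrier: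
  assumes "f \<in> N \<rightarrow>\<^sub>M borel_vec n" "x \<in> space N"
  shows "f x \<in> carrier_vec n"
  using measurable_space[OF assms] by simp

lemma measurable_add_vec [measurable]:
  assumes "f \<in> N \<rightarrow>\<^sub>M borel_vec n" "g \<in> N \<rightarrow>\<^sub>M borel_vec n"
  shows "(\<lambda>x. f x + g x) \<in> N \<rightarrow>\<^sub>M borel_vec n"
proof (rule measurable_borel_vecI)
  note c = measurable_vec_carrier[OF assms(1)] measurable_vec_carrier[OF assms(2)]
  show "f x + g x \<in> carrier_vec n" if "x \<in> space N" for x using c that by auto
  fix j assume j: "j < n"
  have "(\<lambda>x. f x $ j + g x $ j) \<in> borel_measurable N"
    using assms j by (intro borel_measurable_add measurable_borel_vec_index)
  then show "(\<lambda>x. (f x + g x) $ j) \<in> borel_measurable N"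
    by (rule measurable_cong[THEN iffD1, rotated]) (use carrier_vecD[OF c(2)] j in auto)
qed

lemma measurable_diff_vec [measurable]:
  assumes "f \<in> N \<rightarrow>\<^sub>M borel_vec n" "g \<in> N \<rightarrow>\<^sub>M borel_vec n"
  shows "(\<lambda>x. f x - g x) \<in> N \<rightarrow>\<^sub>M borel_vec n"
proof (rule measurable_borel_vecI)
  note c = measurable_vec_carrier[OF assms(1)] measurable_vec_carrier[OF assms(2)]
  show "f x - g x \<in> carrier_vec n" if "x \<in> space N" for x using c that by auto
  fix j assume j: "j < n"
  have "(\<lambda>x. f x $ j - g x $ j) \<in> borel_measurable N"
    using assms j by (intro borel_measurable_diff measurable_borel_vec_index)
  then show "(\<lambda>x. (f x - g x) $ j) \<in> borel_measurable N"
    by (rule measurable_cong[THEN iffD1, rotated]) (use carrier_vecD[OF c(2)] j in auto)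
qed

lemma measurable_scalar_prod [measurable]:
  assumes "f \<in> N \<rightarrow>\<^sub>M borel_vec n" "g \<in> N \<rightarrow>\<^sub>M borel_vec n"
  shows "(\<lambda>x. f x \<bullet> g x) \<in> borel_measurable N"
proof -
  note c = measurable_vec_carrier[OF assms(1)] measurable_vec_carrier[OF assms(2)]
  have "(\<lambda>x. \<Sum>j<n. f x $ j * g x $ j) \<in> borel_measurable N"
    using assms by (intro borel_measurable_sum borel_measurable_times measurable_borel_vec_index) auto
  then show ?thesis
    by (rule measurable_cong[THEN iffD1, rotated])
      (use carrier_vecD[OF c(2)] in \<open>auto simp: scalar_prod_def atLeast0LessThan\<close>)
qed

lemma measurable_mult_mat_vec:
  assumes A: "A \<in> carrier_mat m n" and f: "f \<in> N \<rightarrow>\<^sub>M borel_vec n"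
  shows "(\<lambda>x. A *\<^sub>v f x) \<in> N \<rightarrow>\<^sub>M borel_vec m"
proof (rule measurable_borel_vecI)
  show "A *\<^sub>v f x \<in> carrier_vec m" if "x \<in> space N" for x
    using A by (rule mult_mat_vec_carrier) (rule measurable_vec_carrier[OF f that])
  fix j assume j: "j < m"
  have "(\<lambda>x. row A j \<bullet> f x) \<in> borel_measurable N"
    using A j f by (intro measurable_scalar_prod[where n = n]) auto
  then show "(\<lambda>x. (A *\<^sub>v f x) $ j) \<in> borel_measurable N" using A j by simp
qed

lemma measurable_vec_PiM: "vec n \<in> (\<Pi>\<^sub>M j\<in>{..<n}. borel) \<rightarrow>\<^sub>M borel_vec n"
  by (rule measurable_borel_vecI) auto

lemma measurable_vec_PiM_lborel [measurable]: "vec n \<in> (\<Pi>\<^sub>M j\<in>{..<n}. lborel) \<rightarrow>\<^sub>M borel_vec n"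
  using measurable_vec_PiM by (simp cong: measurable_cong_sets sets_PiM_cong)

interpretation lborel_product: product_sigma_finite "\<lambda>_::nat. lborel :: real measure"
  by standard

text \<open>Reading off coordinates inverts \<open>vec n\<close>, so it pushes this measure back to
  the product Lebesgue measure, and sigma-finiteness transfers from an image measure to its source.
  This is what licenses Tonelli's theorem below.\<close>

lemma sigma_finite_lborel_vec: "sigma_finite_measure (lborel_vec n)"
proof (rule sigma_finite_measure_distr)
  let ?P = "\<Pi>\<^sub>M j\<in>{..<n}. lborel :: real measure"
  let ?g = "\<lambda>v::real vec. \<lambda>j\<in>{..<n}. v $ j"
  show g: "?g \<in> lborel_vec n \<rightarrow>\<^sub>M ?P" by measurable
  have "distr (lborel_vec n) ?P ?g = distr ?P ?P (?g \<circ> vec n)"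
    unfolding lborel_vec_def using g by (intro distr_distr) auto
  \<comment> \<open>Points of the product space are extensional on \<open>{..<n}\<close>, so
    restricting them changes nothing.\<close>
  also have "\<dots> = distr ?P ?P (\<lambda>x. x)"
    by (intro distr_cong refl) (auto simp: space_PiM fun_eq_iff PiE_def extensional_def)
  finally have "distr (lborel_vec n) ?P ?g = ?P" by (simp add: distr_id)
  then show "sigma_finite_measure (distr (lborel_vec n) ?P ?g)"
    using lborel_product.sigma_finite[of "{..<n}"] by simp
qed

text \<open>A product measure is determined by its values on boxes, and the preimage of a box under
  a translation is a box whose sides are translated separately.\<close>

lemma distr_PiM_lborel_translate:
  "distr (\<Pi>\<^sub>M j\<in>{..<n}. lborel) (\<Pi>\<^sub>M j\<in>{..<n}. lborel) (\<lambda>x. \<lambda>j\<in>{..<n}. x j + c j) =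
    (\<Pi>\<^sub>M j\<in>{..<n::nat}. lborel :: real measure)" (is "distr ?P ?P ?T = _")
proof (rule lborel_product.PiM_eqI)
  fix A :: "nat \<Rightarrow> real set" assume A: "\<And>j. j \<in> {..<n} \<Longrightarrow> A j \<in> sets lborel"
  have T: "?T \<in> ?P \<rightarrow>\<^sub>M ?P" by measurable
  have B: "(\<lambda>x. x + c j) -` A j \<in> sets lborel" if "j \<in> {..<n}" for j
    using measurable_sets[of "\<lambda>x. x + c j" lborel lborel "A j"] A[OF that] by simp
  have "emeasure (distr ?P ?P ?T) (Pi\<^sub>E {..<n} A) = emeasure ?P (?T -` Pi\<^sub>E {..<n} A \<inter> space ?P)"
    using A by (intro emeasure_distr[OF T] sets_PiM_I_finite) auto
  also have "?T -` Pi\<^sub>E {..<n} A \<inter> space ?P = Pi\<^sub>E {..<n} (\<lambda>j. (\<lambda>x. x + c j) -` A j)"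
    by (auto simp: space_PiM PiE_def Pi_def extensional_def)
  also have "emeasure ?P \<dots> = (\<Prod>j<n. emeasure lborel ((\<lambda>x. x + c j) -` A j))"
    using B by (intro lborel_product.emeasure_PiM) auto
  also have "\<dots> = (\<Prod>j<n. emeasure lborel (A j))"
  proof (rule prod.cong)
    fix j assume "j \<in> {..<n}"
    then have "emeasure (distr lborel borel ((+) (c j))) (A j) = emeasure lborel ((+) (c j) -` A j)"
      using A by (subst emeasure_distr) auto
    moreover have "(+) (c j) = (\<lambda>x. x + c j)" by (simp add: fun_eq_iff)
    ultimately show "emeasure lborel ((\<lambda>x. x + c j) -` A j) = emeasure lborel (A j)"
      using lborel_distr_plus[of "c j"] by simp
  qed simp
  finally show "emeasure (distr ?P ?P ?T) (Pi\<^sub>E {..<n} A) = (\<Prod>j\<in>{..<n}. emeasure lborel (A j))" .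
qed auto

text \<open>The basic substitution rule of the development: a shear is, for each fixed value of one
  variable, a translation in the other, so no Jacobian formula is involved.\<close>

lemma nn_integral_lborel_vec_translate:
  assumes f: "f \<in> borel_measurable (borel_vec n)" and c: "c \<in> carrier_vec n"
  shows "(\<integral>\<^sup>+v. f (v + c) \<partial>lborel_vec n) = (\<integral>\<^sup>+v. f v \<partial>lborel_vec n)"
proof -
  let ?P = "\<Pi>\<^sub>M j\<in>{..<n}. lborel :: real measure"
  let ?T = "\<lambda>x. \<lambda>j\<in>{..<n}. x j + c $ j"
  have T: "?T \<in> ?P \<rightarrow>\<^sub>M ?P" by measurable
  have fv [measurable]: "(\<lambda>x. f (vec n x)) \<in> borel_measurable ?P"
    using measurable_compose[OF measurable_vec_PiM_lborel f] .
  have "(\<lambda>v. v + c) \<in> borel_vec n \<rightarrow>\<^sub>M borel_vec n" using c by (intro measurable_add_vec) auto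
  from measurable_compose[OF this f] have fc: "(\<lambda>v. f (v + c)) \<in> borel_measurable (borel_vec n)" .
  have "(\<integral>\<^sup>+v. f (v + c) \<partial>lborel_vec n) = (\<integral>\<^sup>+x. f (vec n x + c) \<partial>?P)"
    unfolding lborel_vec_def by (rule nn_integral_distr[OF measurable_vec_PiM_lborel]) (use fc in simp)
  also have "\<dots> = (\<integral>\<^sup>+x. f (vec n (?T x)) \<partial>?P)"
    using c by (intro nn_integral_cong arg_cong[where f = f] eq_vecI) auto
  also have "\<dots> = (\<integral>\<^sup>+x. f (vec n x) \<partial>distr ?P ?P ?T)"
    by (rule nn_integral_distr[OF T, symmetric]) (use fv in simp)
  also have "\<dots> = (\<integral>\<^sup>+x. f (vec n x) \<partial>?P)" by (simp add: distr_PiM_lborel_translate)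
  also have "\<dots> = (\<integral>\<^sup>+v. f v \<partial>lborel_vec n)"
    unfolding lborel_vec_def by (rule nn_integral_distr[OF measurable_vec_PiM_lborel, symmetric]) (use f in simp)
  finally show ?thesis .
qed

lemma nn_integral_lborel_vec_translate_diff:
  assumes f: "f \<in> borel_measurable (borel_vec n)" and c: "c \<in> carrier_vec n"
  shows "(\<integral>\<^sup>+v. f (v - c) \<partial>lborel_vec n) = (\<integral>\<^sup>+v. f v \<partial>lborel_vec n)"
proof -
  have "(\<integral>\<^sup>+v. f (v + - c) \<partial>lborel_vec n) = (\<integral>\<^sup>+v. f v \<partial>lborel_vec n)"
    using c by (intro nn_integral_lborel_vec_translate f) simp
  moreover have "(\<integral>\<^sup>+v. f (v + - c) \<partial>lborel_vec n) = (\<integral>\<^sup>+v. f (v - c) \<partial>lborel_vec n)"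
    using c by (intro nn_integral_cong arg_cong[where f = f] eq_vecI) auto
  ultimately show ?thesis by simp
qed

section \<open>Gaussian kernels\<close>

lemma sinh_mult_le:
  fixes t v :: real
  assumes "0 \<le> t" "t \<le> 1" "0 \<le> v"
  shows "sinh (t * v) \<le> t * sinh v"
proof -
  have "t * sinh 0 - sinh (t * 0) \<le> t * sinh v - sinh (t * v)"
  proof (rule DERIV_nonneg_imp_nondecreasing[OF assms(3)])
    fix x :: real assume "0 \<le> x" "x \<le> v"
    then have "cosh (t * x) \<le> cosh x"
      using assms by (subst cosh_real_nonneg_le_iff) (auto simp: mult_left_le_one_le)
    then have "t * cosh x - t * cosh (t * x) \<ge> 0" using assms by (simp add: mult_left_mono)
    moreover have "((\<lambda>x. t * sinh x - sinh (t * x)) has_real_derivative t * cosh x - t * cosh (t * x)) (at x)"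
      by (auto intro!: derivative_eq_intros)
    ultimately show "\<exists>y. ((\<lambda>x. t * sinh x - sinh (t * x)) has_real_derivative y) (at x) \<and> 0 \<le> y" by blast
  qed
  then show ?thesis by simp
qed

text \<open>Divided by \<open>t^2\<close>, this bounds the second difference quotient of
  \<open>exp\<close> uniformly for \<open>t\<close> in (0, 1], as dominated convergence will
  require.\<close>

lemma exp_second_difference_bound:
  fixes t y :: real
  assumes "0 \<le> t" "t \<le> 1"
  shows "\<bar>exp (t * y) + exp (- (t * y)) - 2\<bar> \<le> t\<^sup>2 * (exp y + exp (- y))"
proof -
  \<comment> \<open>Half-angle identity; the absolute value makes the argument of
    \<open>sinh\<close> nonnegative, as \<open>sinh_mult_le\<close> demands.\<close>
  have sq: "exp u + exp (- u) - 2 = 4 * (sinh \<bar>u / 2\<bar>)\<^sup>2" for u :: real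
  proof -
    have "exp u = (exp (u / 2))\<^sup>2" "exp (- u) = (exp (- (u / 2)))\<^sup>2" "exp (u / 2) * exp (- (u / 2)) = 1"
      by (simp_all add: power2_eq_square flip: exp_add)
    then have "exp u + exp (- u) - 2 = 4 * (sinh (u / 2))\<^sup>2"
      by (simp add: sinh_def power2_eq_square field_simps)
    then show ?thesis by (simp add: abs_if)
  qed
  have "sinh \<bar>t * y / 2\<bar> \<le> t * sinh \<bar>y / 2\<bar>"
    using sinh_mult_le[OF assms, of "\<bar>y / 2\<bar>"] assms by (simp add: abs_mult)
  then have "(sinh \<bar>t * y / 2\<bar>)\<^sup>2 \<le> (t * sinh \<bar>y / 2\<bar>)\<^sup>2"
    by (intro power_mono) auto
  then have "\<bar>exp (t * y) + exp (- (t * y)) - 2\<bar> \<le> t\<^sup>2 * (exp y + exp (- y) - 2)"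
    unfolding sq by (simp add: power_mult_distrib)
  also have "\<dots> \<le> t\<^sup>2 * (exp y + exp (- y))" by (intro mult_left_mono) auto
  finally show ?thesis .
qed

text \<open>The second moment is the second derivative of the moment generating function at 0, taken
  as a limit of symmetric second differences. The dominating function is integrable by the
  hypothesis at 1 and -1. The number \<open>z\<close> is the total mass (\<open>t = 0\<close>), so
  \<open>N\<close> need not be normalised.\<close>

lemma second_moment_of_gaussian_mgf:
  fixes s z :: real
  assumes mgf: "\<And>t. has_bochner_integral N (\<lambda>x. exp (t * Y x)) (exp (t\<^sup>2 * s / 2) * z)"
    and [measurable]: "Y \<in> borel_measurable N"
  shows "has_bochner_integral N (\<lambda>x. (Y x)\<^sup>2) (s * z)"
proof -
  \<comment> \<open>The shift by 1 keeps every step in (0, 1], where the uniform bound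
    holds.\<close>
  define t :: "nat \<Rightarrow> real" where "t n = 1 / (real n + 1)" for n
  have t: "0 < t n" "t n \<le> 1" for n by (auto simp: t_def)
  let ?g = "\<lambda>n x. (exp (t n * Y x) + exp (- (t n * Y x)) - 2) / (t n)\<^sup>2"
  have g: "has_bochner_integral N (?g n)
    ((exp ((t n)\<^sup>2 * s / 2) * z + exp ((t n)\<^sup>2 * s / 2) * z - 2 * z) / (t n)\<^sup>2)" for n
    using has_bochner_integral_divide_zero[OF has_bochner_integral_diff[OF
        has_bochner_integral_add[OF mgf[of "t n"] mgf[of "- t n"]]
        has_bochner_integral_mult_right[OF mgf[of 0], of 2]], of "(t n)\<^sup>2"]
    by simp
  have lim: "(\<lambda>n. ?g n x) \<longlonglongrightarrow> (Y x)\<^sup>2" for x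
  proof -
    have "(\<lambda>n. (exp (1 / (real n + 1) * y) + exp (- (1 / (real n + 1) * y)) - 2) / (1 / (real n + 1))\<^sup>2)
       \<longlonglongrightarrow> y * y" for y
    proof (cases y "0 :: real" rule: linorder_cases)
      case less
      then show ?thesis by real_asymp
    next
      case greater
      then show ?thesis by real_asymp
    qed simp
    then show ?thesis unfolding t_def power2_eq_square[of "Y x"] .
  qed
  have lim2: "(\<lambda>n. (exp ((t n)\<^sup>2 * s / 2) * z + exp ((t n)\<^sup>2 * s / 2) * z - 2 * z) / (t n)\<^sup>2) \<longlonglongrightarrow> s * z"
  proof -
    have "(\<lambda>n. 2 * (exp ((1 / (real n + 1))\<^sup>2 * s / 2) - 1) / (1 / (real n + 1))\<^sup>2 * z) \<longlonglongrightarrow> s * z"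
      by (intro tendsto_mult_right) real_asymp
    then show ?thesis unfolding t_def by (simp add: algebra_simps)
  qed
  have int: "integrable N (\<lambda>x. exp (Y x) + exp (- Y x))"
    using mgf[of 1] mgf[of "-1"] by (auto simp: has_bochner_integral_iff)
  have bound: "norm (?g n x) \<le> exp (Y x) + exp (- Y x)" for n x
    using exp_second_difference_bound[OF less_imp_le[OF t(1)[of n]] t(2), of "Y x"] t[of n]
    by (simp add: field_simps)
  have "integrable N (\<lambda>x. (Y x)\<^sup>2)"
    by (rule integrable_dominated_convergence[where s = ?g, OF _ _ int]) (use lim bound in auto)
  moreover have "(\<lambda>n. integral\<^sup>L N (?g n)) \<longlonglongrightarrow> (\<integral>x. (Y x)\<^sup>2 \<partial>N)"
    by (rule integral_dominated_convergence[OF _ _ int]) (use lim bound in auto)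
  then have "(\<integral>x. (Y x)\<^sup>2 \<partial>N) = s * z"
    unfolding has_bochner_integral_integral_eq[OF g] by (rule LIMSEQ_unique[OF _ lim2])
  ultimately show ?thesis by (simp add: has_bochner_integral_iff)
qed

lemma add_diff_cancel_vec:
  fixes x y :: "real vec"
  assumes "x \<in> carrier_vec n" "y \<in> carrier_vec n"
  shows "x + y - y = x"
  using assms by (intro eq_vecI) auto

lemma wnorm2_add:
  assumes "sym_mat n B" "x \<in> carrier_vec n" "y \<in> carrier_vec n"
  shows "wnorm2 B (x + y) = wnorm2 B x + 2 * (x \<bullet> (B *\<^sub>v y)) + wnorm2 B y"
proof -
  have B: "B \<in> carrier_mat n n" using assms(1) by (simp add: sym_mat_def)
  note c = mult_mat_vec_carrier[OF B assms(2)] mult_mat_vec_carrier[OF B assms(3)]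
  show ?thesis
    using assms c sym_mat_scalar_prod[OF assms]
    by (simp add: wnorm2_def mult_add_distrib_mat_vec[OF B] add_scalar_prod_distrib[where n = n]
        scalar_prod_add_distrib[where n = n])
qed

lemma wnorm2_smult:
  assumes "B \<in> carrier_mat n n" "x \<in> carrier_vec n"
  shows "wnorm2 B (t \<cdot>\<^sub>v x) = t\<^sup>2 * wnorm2 B x"
  using assms mult_mat_vec_carrier[OF assms]
  by (simp add: wnorm2_def mult_mat_vec[OF assms] power2_eq_square)

lemma wnorm2_diff:
  assumes "sym_mat n B" "x \<in> carrier_vec n" "y \<in> carrier_vec n"
  shows "wnorm2 B (x - y) = wnorm2 B x - 2 * (x \<bullet> (B *\<^sub>v y)) + wnorm2 B y"
proof -
  have B: "B \<in> carrier_mat n n" using assms(1) by (simp add: sym_mat_def)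
  have "x - y = x + (- 1) \<cdot>\<^sub>v y" using assms by (intro eq_vecI) auto
  then show ?thesis
    using wnorm2_add[OF assms(1,2), of "(- 1) \<cdot>\<^sub>v y"] assms mult_mat_vec_carrier[OF B assms(3)]
    by (simp add: wnorm2_smult[OF B] mult_mat_vec[OF B])
qed

lemma measurable_wnorm2:
  assumes B: "B \<in> carrier_mat n n" and f: "f \<in> N \<rightarrow>\<^sub>M borel_vec n"
  shows "(\<lambda>x. wnorm2 B (f x)) \<in> borel_measurable N"
  unfolding wnorm2_def by (intro measurable_scalar_prod[where n = n] f measurable_mult_mat_vec[OF B])

text \<open>The unnormalised density of the centred Gaussian law with precision \<open>B\<close>,
  taken in \<open>ennreal\<close> so that integrals can be exchanged and factored before finiteness
  is known.\<close>

definition gauss_kernel :: "real mat \<Rightarrow> real vec \<Rightarrow> ennreal" where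
  "gauss_kernel B x = ennreal (exp (- wnorm2 B x / 2))"

lemma measurable_gauss_kernel:
  assumes "B \<in> carrier_mat n n" "f \<in> N \<rightarrow>\<^sub>M borel_vec n"
  shows "(\<lambda>x. gauss_kernel B (f x)) \<in> borel_measurable N"
  unfolding gauss_kernel_def
  using measurable_wnorm2[OF assms] by (intro measurable_compose[OF _ measurable_ennreal]
      borel_measurable_exp borel_measurable_divide borel_measurable_uminus) auto

text \<open>Translation invariance of the Lebesgue measure applied to the translates by \<open>t \<cdot>\<^sub>v a\<close>
  shows that \<open>(B *\<^sub>v a) \<bullet> x\<close> has the moment generating function of a centred normal variable.\<close>

lemma gauss_kernel_second_moment:
  assumes B: "sym_mat n B" and a: "a \<in> carrier_vec n"
    and fin: "(\<integral>\<^sup>+x. gauss_kernel B x \<partial>lborel_vec n) < \<infinity>"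
  shows "(\<integral>\<^sup>+x. ennreal (((B *\<^sub>v a) \<bullet> x)\<^sup>2) * gauss_kernel B x \<partial>lborel_vec n)
    = ennreal (wnorm2 B a) * (\<integral>\<^sup>+x. gauss_kernel B x \<partial>lborel_vec n)"
proof -
  have Bc: "B \<in> carrier_mat n n" using B by (simp add: sym_mat_def)
  let ?K = "gauss_kernel B" and ?L = "lborel_vec n"
  have K [measurable]: "?K \<in> borel_measurable (borel_vec n)"
    using measurable_gauss_kernel[OF Bc measurable_ident_sets[OF refl]] by simp
  have Ba: "B *\<^sub>v a \<in> carrier_vec n" using Bc a by (rule mult_mat_vec_carrier)
  define Y where "Y x = (B *\<^sub>v a) \<bullet> x" for x
  have Y [measurable]: "Y \<in> borel_measurable (borel_vec n)"
    unfolding Y_def using Ba by (intro measurable_scalar_prod[where n = n]) auto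
  define N where "N = density ?L ?K"
  define s where "s = wnorm2 B a"
  define Z where "Z = (\<integral>\<^sup>+x. ?K x \<partial>?L)"
  define z where "z = enn2real Z"
  have Z: "Z = ennreal z" using fin by (simp add: Z_def z_def ennreal_enn2real_if less_top)
  have z0: "z \<ge> 0" by (simp add: z_def)
  have setsN [measurable_cong]: "sets N = sets (borel_vec n)" by (simp add: N_def)
  have mgf: "has_bochner_integral N (\<lambda>x. exp (t * Y x)) (exp (t\<^sup>2 * s / 2) * z)" for t
  proof (rule has_bochner_integral_nn_integral)
    have "?K (x - t \<cdot>\<^sub>v a) = ennreal (exp (- (t\<^sup>2 * s / 2))) * (?K x * ennreal (exp (t * Y x)))"
      if x: "x \<in> carrier_vec n" for x
    proof -
      \<comment> \<open>The cross term of the translated square is linear in \<open>x\<close> and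
        equals \<open>t * Y x\<close> up to a factor: translating the kernel tilts it by
        \<open>exp (t * Y x)\<close>.\<close>
      have "wnorm2 B (x - t \<cdot>\<^sub>v a) = wnorm2 B x - 2 * (t * Y x) + t\<^sup>2 * s"
        using wnorm2_diff[OF B x, of "t \<cdot>\<^sub>v a"] a x Ba comm_scalar_prod[OF Ba x]
        by (simp add: wnorm2_smult[OF Bc] mult_mat_vec[OF Bc] Y_def s_def)
      then show ?thesis
        by (simp add: gauss_kernel_def diff_divide_distrib add_divide_distrib flip: ennreal_mult' exp_add)
    qed
    then have "(\<integral>\<^sup>+x. ?K (x - t \<cdot>\<^sub>v a) \<partial>?L)
        = (\<integral>\<^sup>+x. ennreal (exp (- (t\<^sup>2 * s / 2))) * (?K x * ennreal (exp (t * Y x))) \<partial>?L)"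
      by (intro nn_integral_cong) simp
    also have "\<dots> = ennreal (exp (- (t\<^sup>2 * s / 2))) * (\<integral>\<^sup>+x. ennreal (exp (t * Y x)) \<partial>N)"
      unfolding N_def by (subst nn_integral_cmult) (auto simp: nn_integral_density)
    finally have "ennreal z = ennreal (exp (- (t\<^sup>2 * s / 2))) * (\<integral>\<^sup>+x. ennreal (exp (t * Y x)) \<partial>N)"
      using nn_integral_lborel_vec_translate_diff[OF K, of "t \<cdot>\<^sub>v a"] a Z by (simp add: Z_def)
    \<comment> \<open>The factor is moved across by multiplying with its reciprocal.\<close>
    then have "ennreal (exp (t\<^sup>2 * s / 2)) * ennreal z
      = ennreal (exp (t\<^sup>2 * s / 2) * exp (- (t\<^sup>2 * s / 2))) * (\<integral>\<^sup>+x. ennreal (exp (t * Y x)) \<partial>N)"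
      by (simp add: ennreal_mult' mult.assoc)
    then show "(\<integral>\<^sup>+x. ennreal (exp (t * Y x)) \<partial>N) = ennreal (exp (t\<^sup>2 * s / 2) * z)"
      using z0 by (simp add: ennreal_mult' flip: exp_add)
  qed (use z0 in auto)
  have "(\<integral>\<^sup>+x. ennreal ((Y x)\<^sup>2) * ?K x \<partial>?L) = (\<integral>\<^sup>+x. ennreal ((Y x)\<^sup>2) \<partial>N)"
    unfolding N_def by (subst nn_integral_density) (simp_all add: mult.commute)
  also have hb: "has_bochner_integral N (\<lambda>x. (Y x)\<^sup>2) (s * z)"
    by (rule second_moment_of_gaussian_mgf[OF mgf]) measurable
  have "(\<integral>\<^sup>+x. ennreal ((Y x)\<^sup>2) \<partial>N) = ennreal (s * z)"
    using nn_integral_eq_integral[of N "\<lambda>x. (Y x)\<^sup>2"] hb by (simp add: has_bochner_integral_iff)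
  also have "\<dots> = ennreal s * Z" using z0 by (simp add: Z ennreal_mult'')
  finally show ?thesis by (simp add: Y_def s_def Z_def)
qed

section \<open>Completing the square in the joint density\<close>

context linear_model
begin

lemma gain_mult_vec:
  assumes "z \<in> carrier_vec k"
  shows "gain *\<^sub>v z = minv precision *\<^sub>v (transpose_mat H *\<^sub>v (minv R *\<^sub>v z))"
proof -
  note P = pd_mat_minv(1)[OF pd_precision]
  note PH = mult_carrier_mat[OF P carriers(3)]
  show ?thesis
    unfolding gain_def assoc_mult_mat_vec[OF PH carriers(5) assms]
      assoc_mult_mat_vec[OF P carriers(3) mult_mat_vec_carrier[OF carriers(5) assms]] ..
qed

lemma gain_carrier [simp]: "gain \<in> carrier_mat n k"
  using mult_carrier_mat[OF mult_carrier_mat[OF pd_mat_minv(1)[OF pd_precision] carriers(3)] carriers(5)]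
  by (simp add: gain_def)

lemma precision_gain:
  assumes "z \<in> carrier_vec k"
  shows "precision *\<^sub>v (gain *\<^sub>v z) = transpose_mat H *\<^sub>v (minv R *\<^sub>v z)"
  unfolding gain_mult_vec[OF assms]
  by (rule pd_mat_minv_mult(1)[OF pd_precision])
    (rule mult_mat_vec_carrier[OF carriers(3) mult_mat_vec_carrier[OF carriers(5) assms]])

text \<open>\<open>w = gain z\<close> solves \<open>precision w = H^T R^-1 z\<close>, so it is the
  stationary point of the exponent. The prior and noise forms at \<open>x = e + w\<close> combine
  into the form of \<open>precision\<close> at \<open>x\<close>, whose term
  \<open>2 e . precision w\<close> is cancelled by the cross term of the misfit.\<close>

lemma complete_square:
  assumes e: "e \<in> carrier_vec n" and z: "z \<in> carrier_vec k"
  shows "wnorm2 Q (e + gain *\<^sub>v z) + wnorm2 (minv R) (z - H *\<^sub>v (e + gain *\<^sub>v z))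
    = wnorm2 precision e + (wnorm2 (minv R) z - wnorm2 precision (gain *\<^sub>v z))"
proof -
  define w where "w = gain *\<^sub>v z"
  define x where "x = e + w"
  have w: "w \<in> carrier_vec n" unfolding w_def by (rule mult_mat_vec_carrier[OF gain_carrier z])
  have x: "x \<in> carrier_vec n" using e w by (simp add: x_def)
  have Hx: "H *\<^sub>v x \<in> carrier_vec k" by (rule mult_mat_vec_carrier[OF carriers(2) x])
  have Rz: "minv R *\<^sub>v z \<in> carrier_vec k" by (rule mult_mat_vec_carrier[OF carriers(5) z])
  have Aw: "precision *\<^sub>v w \<in> carrier_vec n" by (rule mult_mat_vec_carrier[OF carriers(6) w])
  have Rs: "sym_mat k (minv R)" by (rule pd_mat_sym[OF pd_mat_minv_pd[OF R]])
  have "wnorm2 (minv R) (z - H *\<^sub>v x) =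
    wnorm2 (minv R) z - 2 * ((H *\<^sub>v x) \<bullet> (minv R *\<^sub>v z)) + wnorm2 (minv R) (H *\<^sub>v x)"
    using wnorm2_diff[OF Rs z Hx] sym_mat_scalar_prod[OF Rs z Hx] by simp
  moreover have "(H *\<^sub>v x) \<bullet> (minv R *\<^sub>v z) = x \<bullet> (precision *\<^sub>v w)"
    using transpose_scalar_prod[OF x Rz] precision_gain[OF z] by (simp add: w_def)
  moreover have "x \<bullet> (precision *\<^sub>v w) = e \<bullet> (precision *\<^sub>v w) + wnorm2 precision w"
    unfolding x_def wnorm2_def by (rule add_scalar_prod_distrib[OF e w Aw])
  moreover have "wnorm2 Q x + wnorm2 (minv R) (H *\<^sub>v x) = wnorm2 precision x"
    using scalar_prod_precision[OF x x] by (simp add: wnorm2_def)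
  moreover have "wnorm2 precision x = wnorm2 precision e + 2 * (e \<bullet> (precision *\<^sub>v w)) + wnorm2 precision w"
    unfolding x_def by (rule wnorm2_add[OF pd_mat_sym[OF pd_precision] e w])
  ultimately show ?thesis unfolding x_def w_def by linarith
qed

definition evidence_kernel :: "real vec \<Rightarrow> ennreal" where
  "evidence_kernel z = ennreal (exp (- (wnorm2 (minv R) z - wnorm2 precision (gain *\<^sub>v z)) / 2))"

text \<open>The two shears \<open>(x, h) \<mapsto> (x, z)\<close> with \<open>z = H x + h\<close> and \<open>(x, z) \<mapsto> (x - gain z, z)\<close> preserve
  the Lebesgue measure and turn the joint density into a product.\<close>

lemma nn_integral_factor:
  assumes f: "f \<in> borel_measurable (borel_vec n)" and g: "g \<in> borel_measurable (borel_vec k)"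
  shows "(\<integral>\<^sup>+x. \<integral>\<^sup>+h. gauss_kernel Q x * gauss_kernel (minv R) h *
        (f (x - gain *\<^sub>v (H *\<^sub>v x + h)) * g (H *\<^sub>v x + h)) \<partial>lborel_vec k \<partial>lborel_vec n)
    = (\<integral>\<^sup>+e. f e * gauss_kernel precision e \<partial>lborel_vec n) * (\<integral>\<^sup>+z. g z * evidence_kernel z \<partial>lborel_vec k)"
proof -
  let ?L = "lborel_vec n" and ?N = "lborel_vec k"
  interpret L: sigma_finite_measure ?L by (rule sigma_finite_lborel_vec)
  interpret N: sigma_finite_measure ?N by (rule sigma_finite_lborel_vec)
  interpret LN: pair_sigma_finite ?L ?N ..
  define F where "F x z = gauss_kernel Q x * gauss_kernel (minv R) (z - H *\<^sub>v x) * (f (x - gain *\<^sub>v z) * g z)" for x z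
  \<comment> \<open>Arbitrary measurable arguments cover three uses at once: joint measurability and
    the sections in either variable.\<close>
  have F: "(\<lambda>p. F (u p) (v p)) \<in> borel_measurable X"
    if u: "u \<in> X \<rightarrow>\<^sub>M borel_vec n" and v: "v \<in> X \<rightarrow>\<^sub>M borel_vec k" for X :: "'c measure" and u v
    unfolding F_def
    by (intro borel_measurable_times_ennreal measurable_gauss_kernel[where n = n] measurable_gauss_kernel[where n = k]
        measurable_compose[OF _ f] measurable_compose[OF _ g] measurable_diff_vec measurable_mult_mat_vec[where n = n]
        measurable_mult_mat_vec[where n = k] u v carriers gain_carrier)
  have c: "H *\<^sub>v x \<in> carrier_vec k" if "x \<in> carrier_vec n" for x by (rule mult_mat_vec_carrier[OF carriers(2) that])
  have "(\<integral>\<^sup>+h. gauss_kernel Q x * gauss_kernel (minv R) h * (f (x - gain *\<^sub>v (H *\<^sub>v x + h)) * g (H *\<^sub>v x + h)) \<partial>?N)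
      = (\<integral>\<^sup>+z. F x z \<partial>?N)" if x: "x \<in> carrier_vec n" for x
  proof -
    have "(\<integral>\<^sup>+h. gauss_kernel Q x * gauss_kernel (minv R) h * (f (x - gain *\<^sub>v (H *\<^sub>v x + h)) * g (H *\<^sub>v x + h)) \<partial>?N)
      = (\<integral>\<^sup>+h. F x (h + H *\<^sub>v x) \<partial>?N)"
    proof (rule nn_integral_cong)
      fix h assume "h \<in> space ?N"
      then have h: "h \<in> carrier_vec k" by simp
      have "h + H *\<^sub>v x - H *\<^sub>v x = h" by (rule add_diff_cancel_vec[OF h c[OF x]])
      moreover have "H *\<^sub>v x + h = h + H *\<^sub>v x" by (rule comm_add_vec[OF c[OF x] h])
      ultimately show "gauss_kernel Q x * gauss_kernel (minv R) h * (f (x - gain *\<^sub>v (H *\<^sub>v x + h)) * g (H *\<^sub>v x + h))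
        = F x (h + H *\<^sub>v x)" by (simp add: F_def)
    qed
    also have "\<dots> = (\<integral>\<^sup>+z. F x z \<partial>?N)"
      using x by (intro nn_integral_lborel_vec_translate F c) auto
    finally show ?thesis .
  qed
  then have "(\<integral>\<^sup>+x. \<integral>\<^sup>+h. gauss_kernel Q x * gauss_kernel (minv R) h *
        (f (x - gain *\<^sub>v (H *\<^sub>v x + h)) * g (H *\<^sub>v x + h)) \<partial>?N \<partial>?L) = (\<integral>\<^sup>+x. \<integral>\<^sup>+z. F x z \<partial>?N \<partial>?L)"
    by (rule nn_integral_cong) simp
  \<comment> \<open>The second shift depends on \<open>z\<close>, so \<open>x\<close> must become
    the inner variable before translating by \<open>gain z\<close>.\<close>
  also have "\<dots> = (\<integral>\<^sup>+z. \<integral>\<^sup>+x. F x z \<partial>?L \<partial>?N)"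
  proof (rule LN.Fubini'[symmetric])
    have "(\<lambda>p. F (fst p) (snd p)) \<in> borel_measurable (?L \<Otimes>\<^sub>M ?N)"
      by (rule F) measurable
    then show "(\<lambda>(x, z). F x z) \<in> borel_measurable (?L \<Otimes>\<^sub>M ?N)" by (simp add: case_prod_beta')
  qed
  also have "\<dots> = (\<integral>\<^sup>+z. (\<integral>\<^sup>+e. f e * gauss_kernel precision e \<partial>?L) * (g z * evidence_kernel z) \<partial>?N)"
  proof (rule nn_integral_cong)
    fix z assume "z \<in> space ?N"
    then have z: "z \<in> carrier_vec k" by simp
    have w: "gain *\<^sub>v z \<in> carrier_vec n" by (rule mult_mat_vec_carrier[OF gain_carrier z])
    have "(\<integral>\<^sup>+x. F x z \<partial>?L) = (\<integral>\<^sup>+e. F (e + gain *\<^sub>v z) z \<partial>?L)"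
      using w z by (intro nn_integral_lborel_vec_translate[symmetric] F) auto
    also have "\<dots> = (\<integral>\<^sup>+e. (f e * gauss_kernel precision e) * (g z * evidence_kernel z) \<partial>?L)"
    proof (rule nn_integral_cong)
      fix e assume "e \<in> space ?L"
      then have e: "e \<in> carrier_vec n" by simp
      have e': "e + gain *\<^sub>v z - gain *\<^sub>v z = e" by (rule add_diff_cancel_vec[OF e w])
      have "gauss_kernel Q (e + gain *\<^sub>v z) * gauss_kernel (minv R) (z - H *\<^sub>v (e + gain *\<^sub>v z))
        = gauss_kernel precision e * evidence_kernel z"
        using complete_square[OF e z]
        by (simp add: gauss_kernel_def evidence_kernel_def flip: ennreal_mult' exp_add add_divide_distrib)
           (simp add: field_simps)
      then show "F (e + gain *\<^sub>v z) z = (f e * gauss_kernel precision e) * (g z * evidence_kernel z)"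
        by (simp add: F_def e' ac_simps)
    qed
    also have "\<dots> = (\<integral>\<^sup>+e. f e * gauss_kernel precision e \<partial>?L) * (g z * evidence_kernel z)"
      using measurable_gauss_kernel[OF carriers(6) measurable_ident_sets[OF refl]] f
      by (intro nn_integral_multc borel_measurable_times_ennreal) auto
    finally show "(\<integral>\<^sup>+x. F x z \<partial>?L) = (\<integral>\<^sup>+e. f e * gauss_kernel precision e \<partial>?L) * (g z * evidence_kernel z)" .
  qed
  also have "\<dots> = (\<integral>\<^sup>+e. f e * gauss_kernel precision e \<partial>?L) * (\<integral>\<^sup>+z. g z * evidence_kernel z \<partial>?N)"
  proof (rule nn_integral_cmult)
    note id = measurable_ident_sets[OF refl, of "borel_vec k"]
    have "evidence_kernel \<in> borel_measurable (borel_vec k)"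
      unfolding evidence_kernel_def
      using measurable_wnorm2[OF carriers(5) id]
        measurable_wnorm2[OF carriers(6) measurable_mult_mat_vec[OF gain_carrier id]] by measurable
    then show "(\<lambda>z. g z * evidence_kernel z) \<in> borel_measurable ?N" using g by simp
  qed
  finally show ?thesis .
qed

end

section \<open>The Gaussian linear model\<close>

text \<open>Independence of the generated sigma-algebras is the product rule on rectangles, and
  rectangles determine a product of sigma-finite measures.\<close>

lemma distr_Pair_indep_rv:
  assumes P: "prob_space P" and indep: "indep_rv P A X B Y"
  shows "distr P (A \<Otimes>\<^sub>M B) (\<lambda>\<omega>. (X \<omega>, Y \<omega>)) = distr P A X \<Otimes>\<^sub>M distr P B Y"
proof (rule pair_measure_eqI[symmetric])
  interpret prob_space P by (rule P)
  have X [measurable]: "X \<in> P \<rightarrow>\<^sub>M A" and Y [measurable]: "Y \<in> P \<rightarrow>\<^sub>M B"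
    and ind: "indep_set (sets (vimage_algebra (space P) X A)) (sets (vimage_algebra (space P) Y B))"
    using indep by (auto simp: indep_rv_def)
  show "sigma_finite_measure (distr P A X)" "sigma_finite_measure (distr P B Y)"
    using prob_space_distr[OF X] prob_space_distr[OF Y]
    by (auto intro: prob_space_imp_sigma_finite)
  show "sets (distr P A X \<Otimes>\<^sub>M distr P B Y) = sets (distr P (A \<Otimes>\<^sub>M B) (\<lambda>\<omega>. (X \<omega>, Y \<omega>)))"
    by (simp cong: sets_pair_measure_cong)
  fix a b assume "a \<in> sets (distr P A X)" "b \<in> sets (distr P B Y)"
  then have a [measurable]: "a \<in> sets A" and b [measurable]: "b \<in> sets B" by auto
  have "prob ((X -` a \<inter> space P) \<inter> (Y -` b \<inter> space P)) = prob (X -` a \<inter> space P) * prob (Y -` b \<inter> space P)"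
    by (intro indep_setD[OF ind] in_vimage_algebra a b)
  moreover have "(\<lambda>\<omega>. (X \<omega>, Y \<omega>)) -` (a \<times> b) \<inter> space P = (X -` a \<inter> space P) \<inter> (Y -` b \<inter> space P)"
    by auto
  ultimately show "emeasure (distr P A X) a * emeasure (distr P B Y) b
    = emeasure (distr P (A \<Otimes>\<^sub>M B) (\<lambda>\<omega>. (X \<omega>, Y \<omega>))) (a \<times> b)"
    by (simp add: emeasure_distr emeasure_eq_measure ennreal_mult)
qed

lemma nn_integral_indep_rv:
  assumes P: "prob_space P" and indep: "indep_rv P A X B Y"
    and f: "f \<in> borel_measurable (A \<Otimes>\<^sub>M B)"
  shows "(\<integral>\<^sup>+\<omega>. f (X \<omega>, Y \<omega>) \<partial>P) = (\<integral>\<^sup>+x. \<integral>\<^sup>+y. f (x, y) \<partial>distr P B Y \<partial>distr P A X)"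
proof -
  interpret prob_space P by (rule P)
  have X [measurable]: "X \<in> P \<rightarrow>\<^sub>M A" and Y [measurable]: "Y \<in> P \<rightarrow>\<^sub>M B"
    using indep by (auto simp: indep_rv_def)
  interpret D: sigma_finite_measure "distr P B Y"
    by (intro prob_space_imp_sigma_finite prob_space_distr Y)
  have "(\<integral>\<^sup>+\<omega>. f (X \<omega>, Y \<omega>) \<partial>P) = (\<integral>\<^sup>+p. f p \<partial>distr P (A \<Otimes>\<^sub>M B) (\<lambda>\<omega>. (X \<omega>, Y \<omega>)))"
    by (rule nn_integral_distr[symmetric]) (use f in simp_all)
  also have "\<dots> = (\<integral>\<^sup>+p. f p \<partial>(distr P A X \<Otimes>\<^sub>M distr P B Y))"
    by (simp add: distr_Pair_indep_rv[OF P indep])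
  also have "\<dots> = (\<integral>\<^sup>+x. \<integral>\<^sup>+y. f (x, y) \<partial>distr P B Y \<partial>distr P A X)"
    by (rule D.nn_integral_fst[symmetric]) (use f in \<open>simp cong: measurable_cong_sets sets_pair_measure_cong\<close>)
  finally show ?thesis .
qed

lemma gauss_density_eq_kernel:
  assumes "v \<in> carrier_vec n"
  shows "ennreal (gauss_density n (0\<^sub>v n) S v)
    = ennreal (1 / sqrt ((2 * pi) ^ n * det S)) * gauss_kernel (minv S) v"
proof -
  have v: "v - 0\<^sub>v n = v" using assms by (intro eq_vecI) auto
  show ?thesis unfolding gauss_density_def v gauss_kernel_def wnorm2_def
    by (simp flip: ennreal_mult'')
qed

lemma nn_integral_gaussian_vec:
  assumes X: "gaussian_vec P n X (0\<^sub>v n) S" and B: "minv S \<in> carrier_mat n n"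
    and f: "f \<in> borel_measurable (borel_vec n)"
  shows "(\<integral>\<^sup>+x. f x \<partial>distr P (borel_vec n) X)
    = ennreal (1 / sqrt ((2 * pi) ^ n * det S)) * (\<integral>\<^sup>+x. gauss_kernel (minv S) x * f x \<partial>lborel_vec n)"
proof -
  have d: "(\<lambda>v. ennreal (gauss_density n (0\<^sub>v n) S v)) \<in> borel_measurable (lborel_vec n)"
    "distr P (lborel_vec n) X = density (lborel_vec n) (\<lambda>v. ennreal (gauss_density n (0\<^sub>v n) S v))"
    using X by (auto simp: gaussian_vec_def distributed_def)
  have K: "gauss_kernel (minv S) \<in> borel_measurable (borel_vec n)"
    using measurable_gauss_kernel[OF B measurable_ident_sets[OF refl]] by simp
  have "distr P (borel_vec n) X = distr P (lborel_vec n) X" by (intro distr_cong) auto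
  then have "(\<integral>\<^sup>+x. f x \<partial>distr P (borel_vec n) X)
      = (\<integral>\<^sup>+x. ennreal (gauss_density n (0\<^sub>v n) S x) * f x \<partial>lborel_vec n)"
    using d f by (simp add: nn_integral_density)
  also have "\<dots> = (\<integral>\<^sup>+x. ennreal (1 / sqrt ((2 * pi) ^ n * det S)) * (gauss_kernel (minv S) x * f x) \<partial>lborel_vec n)"
    by (intro nn_integral_cong) (simp add: gauss_density_eq_kernel mult.assoc)
  also have "\<dots> = ennreal (1 / sqrt ((2 * pi) ^ n * det S)) * (\<integral>\<^sup>+x. gauss_kernel (minv S) x * f x \<partial>lborel_vec n)"
    using K f by (intro nn_integral_cmult) simp
  finally show ?thesis .
qed

text \<open>Expanding the square leaves the moments of order 0, 1 and 2; the odd one vanishes. Note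
  that \<sigma> is the standard deviation.\<close>

lemma normal_shifted_second_moment:
  assumes "\<sigma> > 0"
  shows "(\<integral>\<^sup>+t. ennreal ((a + t)\<^sup>2) \<partial>density lborel (\<lambda>t. ennreal (normal_density 0 \<sigma> t))) = ennreal (a\<^sup>2 + \<sigma>\<^sup>2)"
proof -
  have 0: "has_bochner_integral lborel (\<lambda>x. normal_density 0 \<sigma> x) 1"
    using normal_moment_even[OF assms, of 0 0] by simp
  have 1: "has_bochner_integral lborel (\<lambda>x. normal_density 0 \<sigma> x * x) 0"
    using normal_moment_odd[OF assms, of 0 0] by simp
  have 2: "has_bochner_integral lborel (\<lambda>x. normal_density 0 \<sigma> x * x\<^sup>2) (\<sigma>\<^sup>2)"
    using normal_moment_even[OF assms, of 0 1] by simp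
  have "has_bochner_integral lborel (\<lambda>x. a\<^sup>2 * normal_density 0 \<sigma> x + (2 * a) * (normal_density 0 \<sigma> x * x)
      + normal_density 0 \<sigma> x * x\<^sup>2) (a\<^sup>2 * 1 + (2 * a) * 0 + \<sigma>\<^sup>2)"
    by (intro has_bochner_integral_add has_bochner_integral_mult_right 0 1 2)
  then have hb: "has_bochner_integral lborel (\<lambda>x. normal_density 0 \<sigma> x * (a + x)\<^sup>2) (a\<^sup>2 + \<sigma>\<^sup>2)"
    by (simp add: power2_sum algebra_simps)
  have "(\<integral>\<^sup>+t. ennreal ((a + t)\<^sup>2) \<partial>density lborel (\<lambda>t. ennreal (normal_density 0 \<sigma> t)))
    = (\<integral>\<^sup>+t. ennreal (normal_density 0 \<sigma> t * (a + t)\<^sup>2) \<partial>lborel)"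
    by (subst nn_integral_density) (auto simp: ennreal_mult')
  also have "\<dots> = ennreal (a\<^sup>2 + \<sigma>\<^sup>2)"
    using nn_integral_eq_integral[of lborel "\<lambda>x. normal_density 0 \<sigma> x * (a + x)\<^sup>2"] hb
    by (simp add: has_bochner_integral_iff)
  finally show ?thesis .
qed

text \<open>The hypothesis is an identity of nonnegative integrals, so it can be checked before
  integrability is known. The free real factor \<open>r\<close> later becomes the squared weighted
  norm of the response vector.\<close>

lemma (in prob_space) real_cond_exp_constI:
  fixes c r :: real
  assumes sub: "subalgebra M F" and X [measurable]: "X \<in> borel_measurable M" and nonneg: "\<And>\<omega>. X \<omega> \<ge> 0"
    and c: "c \<ge> 0"
    and eq: "\<And>A. A \<in> sets F \<Longrightarrow> (\<integral>\<^sup>+\<omega>. ennreal (X \<omega>) * indicator A \<omega> \<partial>M) = ennreal c * emeasure M A"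
  shows "integrable M X" and "AE \<omega> in M. real_cond_exp M F (\<lambda>\<omega>. X \<omega> * r) \<omega> = c * r"
proof -
  interpret finite_measure_subalgebra M F by standard (rule sub)
  have sets: "A \<in> sets M" if "A \<in> sets F" for A using sub that by (auto simp: subalgebra_def)
  have hb: "has_bochner_integral M (\<lambda>\<omega>. X \<omega> * indicator A \<omega>) (c * prob A)" if A: "A \<in> sets F" for A
  proof (rule has_bochner_integral_nn_integral)
    have [measurable]: "A \<in> sets M" by (rule sets[OF A])
    show "(\<lambda>\<omega>. X \<omega> * indicator A \<omega>) \<in> borel_measurable M" by measurable
    have "(\<integral>\<^sup>+\<omega>. ennreal (X \<omega> * indicator A \<omega>) \<partial>M) = (\<integral>\<^sup>+\<omega>. ennreal (X \<omega>) * indicator A \<omega> \<partial>M)"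
      by (intro nn_integral_cong) (auto split: split_indicator)
    also have "\<dots> = ennreal (c * prob A)" using c by (simp add: eq[OF A] emeasure_eq_measure ennreal_mult)
    finally show "(\<integral>\<^sup>+\<omega>. ennreal (X \<omega> * indicator A \<omega>) \<partial>M) = ennreal (c * prob A)" .
  qed (use nonneg c in \<open>auto split: split_indicator\<close>)
  \<comment> \<open>Testing against the whole space shows that the integral is finite.\<close>
  have "space M \<in> sets F" using sub sets.top[of F] by (simp add: subalgebra_def)
  from hb[OF this] have "integrable M (\<lambda>\<omega>. X \<omega> * indicator (space M) \<omega>)" by (simp add: has_bochner_integral_iff)
  then show int: "integrable M X" by (rule Bochner_Integration.integrable_cong[THEN iffD1, rotated 2]) auto
  show "AE \<omega> in M. real_cond_exp M F (\<lambda>\<omega>. X \<omega> * r) \<omega> = c * r"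
  proof (rule real_cond_exp_charact)
    fix A assume A: "A \<in> sets F"
    have "has_bochner_integral M (\<lambda>\<omega>. (X \<omega> * indicator A \<omega>) * r) (c * prob A * r)"
      by (intro has_bochner_integral_mult_left hb A)
    then have "(\<integral>\<omega>. (X \<omega> * indicator A \<omega>) * r \<partial>M) = c * prob A * r"
      by (rule has_bochner_integral_integral_eq)
    then show "(\<integral>\<omega>\<in>A. X \<omega> * r \<partial>M) = (\<integral>\<omega>\<in>A. c * r \<partial>M)"
      using sets[OF A] by (simp add: set_lebesgue_integral_def mult_ac)
  qed (use int in auto)
qed

section \<open>Posterior error and data as random vectors\<close>

locale gaussian_model = linear_model + prob_space P for P :: "'w measure" +
  fixes \<delta> \<eta> :: "'w \<Rightarrow> real vec"
  assumes prior: "gaussian_vec P n \<delta> (0\<^sub>v n) (minv Q)"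
    and noise: "gaussian_vec P k \<eta> (0\<^sub>v k) R"
    and indep: "indep_rv P (borel_vec n) \<delta> (borel_vec k) \<eta>"
begin

text \<open>Observations with the prediction from \<open>xhat\<close> removed. Like
  \<open>error\<close>, it is a function of the pair (residual, noise) and not of the sample point,
  so that independence of the new noise from this pair applies to it directly.\<close>

definition data :: "real vec \<times> real vec \<Rightarrow> real vec" where
  "data p = H *\<^sub>v fst p + snd p"

definition error :: "real vec \<times> real vec \<Rightarrow> real vec" where
  "error p = fst p - gain *\<^sub>v data p"

lemma measurable_data: "data \<in> borel_vec n \<Otimes>\<^sub>M borel_vec k \<rightarrow>\<^sub>M borel_vec k"
  unfolding data_def
  by (intro measurable_add_vec measurable_mult_mat_vec[OF carriers(2)] measurable_fst measurable_snd)

lemma measurable_error: "error \<in> borel_vec n \<Otimes>\<^sub>M borel_vec k \<rightarrow>\<^sub>M borel_vec n"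
  unfolding error_def
  by (intro measurable_diff_vec measurable_mult_mat_vec[OF gain_carrier] measurable_data measurable_fst)

lemma measurable_pair: "(\<lambda>\<omega>. (\<delta> \<omega>, \<eta> \<omega>)) \<in> P \<rightarrow>\<^sub>M borel_vec n \<Otimes>\<^sub>M borel_vec k"
  using indep by (intro measurable_Pair) (auto simp: indep_rv_def)

definition joint_const :: ennreal where
  "joint_const = ennreal (1 / sqrt ((2 * pi) ^ n * det (minv Q))) * ennreal (1 / sqrt ((2 * pi) ^ k * det R))"

text \<open>Independence of error and data in integrated form: a functional of \<open>f\<close>
  times a functional of \<open>g\<close>. The normalising constants are collected in
  \<open>joint_const\<close>, whose value is irrelevant because it occurs in every such
  product.\<close>

lemma error_data_factor:
  assumes f: "f \<in> borel_measurable (borel_vec n)" and g: "g \<in> borel_measurable (borel_vec k)"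
  shows "(\<integral>\<^sup>+\<omega>. f (error (\<delta> \<omega>, \<eta> \<omega>)) * g (data (\<delta> \<omega>, \<eta> \<omega>)) \<partial>P) = joint_const *
    (\<integral>\<^sup>+e. f e * gauss_kernel precision e \<partial>lborel_vec n) * (\<integral>\<^sup>+z. g z * evidence_kernel z \<partial>lborel_vec k)"
proof -
  let ?c1 = "ennreal (1 / sqrt ((2 * pi) ^ n * det (minv Q)))" and ?c2 = "ennreal (1 / sqrt ((2 * pi) ^ k * det R))"
  let ?F = "\<lambda>p. f (error p) * g (data p)"
  have F: "?F \<in> borel_measurable (borel_vec n \<Otimes>\<^sub>M borel_vec k)"
    by (intro borel_measurable_times_ennreal measurable_compose[OF measurable_error f]
        measurable_compose[OF measurable_data g])
  \<comment> \<open>The prior is specified by its covariance \<open>minv Q\<close>, whereas its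
    kernel uses the precision.\<close>
  have Q': "minv (minv Q) = Q" by (rule minv_minv[OF Q])
  have Kh: "(\<lambda>p. gauss_kernel (minv R) (snd p)) \<in> borel_measurable (borel_vec n \<Otimes>\<^sub>M borel_vec k)"
    by (intro measurable_gauss_kernel[OF carriers(5)] measurable_snd)
  interpret N: sigma_finite_measure "lborel_vec k" by (rule sigma_finite_lborel_vec)
  have "(\<lambda>p. gauss_kernel (minv R) (snd p) * ?F p) \<in> borel_measurable (borel_vec n \<Otimes>\<^sub>M lborel_vec k)"
    using borel_measurable_times_ennreal[OF Kh F] by (simp cong: measurable_cong_sets sets_pair_measure_cong)
  from N.borel_measurable_nn_integral_fst[OF this]
  have inner: "(\<lambda>x. \<integral>\<^sup>+h. gauss_kernel (minv R) h * ?F (x, h) \<partial>lborel_vec k) \<in> borel_measurable (borel_vec n)"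
    by simp
  have sec: "(\<lambda>h. ?F (x, h)) \<in> borel_measurable (borel_vec k)" if "x \<in> carrier_vec n" for x
    using measurable_compose[OF measurable_Pair1' F, of x] that by simp
  have "(\<integral>\<^sup>+\<omega>. ?F (\<delta> \<omega>, \<eta> \<omega>) \<partial>P)
    = (\<integral>\<^sup>+x. \<integral>\<^sup>+h. ?F (x, h) \<partial>distr P (borel_vec k) \<eta> \<partial>distr P (borel_vec n) \<delta>)"
    by (rule nn_integral_indep_rv[OF prob_space_axioms indep F])
  also have "\<dots> = (\<integral>\<^sup>+x. ?c2 * (\<integral>\<^sup>+h. gauss_kernel (minv R) h * ?F (x, h) \<partial>lborel_vec k) \<partial>distr P (borel_vec n) \<delta>)"
    by (intro nn_integral_cong nn_integral_gaussian_vec[OF noise carriers(5)] sec) simp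
  also have "\<dots> = ?c1 * (\<integral>\<^sup>+x. gauss_kernel Q x * (?c2 * (\<integral>\<^sup>+h. gauss_kernel (minv R) h * ?F (x, h) \<partial>lborel_vec k)) \<partial>lborel_vec n)"
    using nn_integral_gaussian_vec[OF prior, unfolded Q', OF carriers(1)] inner by simp
  also have "\<dots> = ?c1 * (\<integral>\<^sup>+x. ?c2 * (gauss_kernel Q x * (\<integral>\<^sup>+h. gauss_kernel (minv R) h * ?F (x, h) \<partial>lborel_vec k)) \<partial>lborel_vec n)"
    by (simp only: mult.left_commute)
  also have "\<dots> = ?c1 * (?c2 * (\<integral>\<^sup>+x. gauss_kernel Q x * (\<integral>\<^sup>+h. gauss_kernel (minv R) h * ?F (x, h) \<partial>lborel_vec k) \<partial>lborel_vec n))"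
    using inner measurable_gauss_kernel[OF carriers(1) measurable_ident_sets[OF refl]]
    by (subst nn_integral_cmult) auto
  also have "(\<integral>\<^sup>+x. gauss_kernel Q x * (\<integral>\<^sup>+h. gauss_kernel (minv R) h * ?F (x, h) \<partial>lborel_vec k) \<partial>lborel_vec n)
    = (\<integral>\<^sup>+x. \<integral>\<^sup>+h. gauss_kernel Q x * gauss_kernel (minv R) h *
        (f (x - gain *\<^sub>v (H *\<^sub>v x + h)) * g (H *\<^sub>v x + h)) \<partial>lborel_vec k \<partial>lborel_vec n)"
  proof (rule nn_integral_cong)
    fix x assume "x \<in> space (lborel_vec n)"
    then have x: "x \<in> carrier_vec n" by simp
    have "gauss_kernel Q x * (\<integral>\<^sup>+h. gauss_kernel (minv R) h * ?F (x, h) \<partial>lborel_vec k)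
      = (\<integral>\<^sup>+h. gauss_kernel Q x * (gauss_kernel (minv R) h * ?F (x, h)) \<partial>lborel_vec k)"
      using sec[OF x] measurable_gauss_kernel[OF carriers(5) measurable_ident_sets[OF refl]]
      by (intro nn_integral_cmult[symmetric]) auto
    then show "gauss_kernel Q x * (\<integral>\<^sup>+h. gauss_kernel (minv R) h * ?F (x, h) \<partial>lborel_vec k)
      = (\<integral>\<^sup>+h. gauss_kernel Q x * gauss_kernel (minv R) h *
        (f (x - gain *\<^sub>v (H *\<^sub>v x + h)) * g (H *\<^sub>v x + h)) \<partial>lborel_vec k)"
      by (simp add: error_def data_def mult.assoc)
  qed
  also note nn_integral_factor[OF f g]
  finally show ?thesis by (simp only: joint_const_def mult.assoc)
qed

lemma error_second_moment:
  assumes i: "i < n" and g: "g \<in> borel_measurable (borel_vec k)"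
  shows "(\<integral>\<^sup>+\<omega>. ennreal ((error (\<delta> \<omega>, \<eta> \<omega>) $ i)\<^sup>2) * g (data (\<delta> \<omega>, \<eta> \<omega>)) \<partial>P)
    = ennreal (minv precision $$ (i, i)) * (\<integral>\<^sup>+\<omega>. g (data (\<delta> \<omega>, \<eta> \<omega>)) \<partial>P)"
proof -
  note c = error_data_factor
  let ?Z = "\<integral>\<^sup>+e. gauss_kernel precision e \<partial>lborel_vec n"
  let ?G = "\<lambda>g. \<integral>\<^sup>+z. g z * evidence_kernel z \<partial>lborel_vec k"
  have "(\<integral>\<^sup>+\<omega>. 1 \<partial>P) = joint_const * ?Z * ?G (\<lambda>_. 1)"
    using c[of "\<lambda>_. 1" "\<lambda>_. 1"] by (simp only: mult_1_left borel_measurable_const)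
  moreover have "(\<integral>\<^sup>+\<omega>. 1 \<partial>P) = 1" by (simp add: emeasure_space_1)
  ultimately have "1 = joint_const * ?Z * ?G (\<lambda>_. 1)" by (simp only:)
  \<comment> \<open>With \<open>f\<close> and \<open>g\<close> constantly 1 the factorisation
    expresses the total mass 1; an infinite factor would make the product 0 or infinite.\<close>
  then have fin: "?Z < \<infinity>"
    by (cases "?Z = \<infinity>") (auto simp: less_top ennreal_mult_top ennreal_top_mult split: if_splits)
  \<comment> \<open>Chosen so that \<open>precision a\<close> is the unit vector: the linear
    functional in the kernel lemma becomes coordinate \<open>i\<close>, and its variance the
    corresponding diagonal entry.\<close>
  define a where "a = minv precision *\<^sub>v unit_vec n i"
  have a: "a \<in> carrier_vec n"
    unfolding a_def by (rule mult_mat_vec_carrier[OF pd_mat_minv(1)[OF pd_precision]]) simp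
  have Pa: "precision *\<^sub>v a = unit_vec n i"
    unfolding a_def by (rule pd_mat_minv_mult(1)[OF pd_precision]) simp
  have Paa: "wnorm2 precision a = minv precision $$ (i, i)"
    using a i mult_unit_vec_index[OF pd_mat_minv(1)[OF pd_precision] i i]
    unfolding wnorm2_def Pa by (simp add: scalar_prod_right_unit[where n = n] a_def)
  have "(\<integral>\<^sup>+e. ennreal ((e $ i)\<^sup>2) * gauss_kernel precision e \<partial>lborel_vec n)
    = (\<integral>\<^sup>+e. ennreal (((precision *\<^sub>v a) \<bullet> e)\<^sup>2) * gauss_kernel precision e \<partial>lborel_vec n)"
    unfolding Pa using i by (intro nn_integral_cong) (simp add: scalar_prod_left_unit[where n = n])
  also have "\<dots> = ennreal (minv precision $$ (i, i)) * ?Z"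
    using gauss_kernel_second_moment[OF pd_mat_sym[OF pd_precision] a fin] by (simp add: Paa)
  finally have sm: "(\<integral>\<^sup>+e. ennreal ((e $ i)\<^sup>2) * gauss_kernel precision e \<partial>lborel_vec n)
    = ennreal (minv precision $$ (i, i)) * ?Z" .
  have "(\<lambda>e. ennreal ((e $ i)\<^sup>2)) \<in> borel_measurable (borel_vec n)"
    using borel_measurable_vec_index[OF i] by measurable
  note f = this
  have "(\<integral>\<^sup>+\<omega>. g (data (\<delta> \<omega>, \<eta> \<omega>)) \<partial>P) = joint_const * ?Z * ?G g"
    using c[of "\<lambda>_. 1", OF _ g] by (simp only: mult_1_left borel_measurable_const)
  then show ?thesis unfolding c[OF f g] sm by (simp only: mult_ac)
qed

text \<open>The new noise is independent of the pair behind error and data, so it is integrated out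
  first and merely adds its variance. The free test function \<open>g\<close> will become an
  indicator of a data event.\<close>

lemma innovation_second_moment:
  fixes \<epsilon> :: "'w \<Rightarrow> real"
  assumes \<sigma>: "\<sigma> > 0" and \<epsilon>: "distributed P lborel \<epsilon> (\<lambda>t. ennreal (normal_density 0 \<sigma> t))"
    and ind: "indep_rv P (borel_vec n \<Otimes>\<^sub>M borel_vec k) (\<lambda>\<omega>. (\<delta> \<omega>, \<eta> \<omega>)) borel \<epsilon>"
    and i: "i < n" and g: "g \<in> borel_measurable (borel_vec k)"
  shows "(\<integral>\<^sup>+\<omega>. ennreal ((error (\<delta> \<omega>, \<eta> \<omega>) $ i + \<epsilon> \<omega>)\<^sup>2) * g (data (\<delta> \<omega>, \<eta> \<omega>)) \<partial>P)
    = ennreal (\<sigma>\<^sup>2 + minv precision $$ (i, i)) * (\<integral>\<^sup>+\<omega>. g (data (\<delta> \<omega>, \<eta> \<omega>)) \<partial>P)"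
proof -
  let ?B = "borel_vec n \<Otimes>\<^sub>M borel_vec k" and ?p = "\<lambda>\<omega>. (\<delta> \<omega>, \<eta> \<omega>)"
  have err: "(\<lambda>p. error p $ i) \<in> borel_measurable ?B" by (rule measurable_borel_vec_index[OF measurable_error i])
  have gd: "(\<lambda>p. g (data p)) \<in> borel_measurable ?B" by (rule measurable_compose[OF measurable_data g])
  let ?F = "\<lambda>q. ennreal ((error (fst q) $ i + snd q)\<^sup>2) * g (data (fst q))"
  have F: "?F \<in> borel_measurable (?B \<Otimes>\<^sub>M borel)"
    using measurable_compose[OF measurable_fst err, of borel] measurable_compose[OF measurable_fst gd, of borel] by measurable
  have dist: "distr P borel \<epsilon> = density lborel (\<lambda>t. ennreal (normal_density 0 \<sigma> t))"
  proof -
    have "distr P borel \<epsilon> = distr P lborel \<epsilon>" by (intro distr_cong) auto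
    then show ?thesis using \<epsilon> by (simp add: distributed_def)
  qed
  have "(\<integral>\<^sup>+\<omega>. ?F (?p \<omega>, \<epsilon> \<omega>) \<partial>P) = (\<integral>\<^sup>+p. \<integral>\<^sup>+t. ?F (p, t) \<partial>distr P borel \<epsilon> \<partial>distr P ?B ?p)"
    by (rule nn_integral_indep_rv[OF prob_space_axioms ind F])
  also have "\<dots> = (\<integral>\<^sup>+p. ennreal ((error p $ i)\<^sup>2 + \<sigma>\<^sup>2) * g (data p) \<partial>distr P ?B ?p)"
    unfolding dist by (intro nn_integral_cong) (simp add: nn_integral_multc normal_shifted_second_moment[OF \<sigma>])
  also have "\<dots> = (\<integral>\<^sup>+\<omega>. ennreal ((error (?p \<omega>) $ i)\<^sup>2 + \<sigma>\<^sup>2) * g (data (?p \<omega>)) \<partial>P)"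
    by (rule nn_integral_distr[OF measurable_pair]) (use err gd in measurable)
  also have "\<dots> = (\<integral>\<^sup>+\<omega>. ennreal ((error (?p \<omega>) $ i)\<^sup>2) * g (data (?p \<omega>)) + ennreal (\<sigma>\<^sup>2) * g (data (?p \<omega>)) \<partial>P)"
    by (intro nn_integral_cong) (simp add: ennreal_plus distrib_right)
  also have "\<dots> = ennreal (minv precision $$ (i, i)) * (\<integral>\<^sup>+\<omega>. g (data (?p \<omega>)) \<partial>P)
      + ennreal (\<sigma>\<^sup>2) * (\<integral>\<^sup>+\<omega>. g (data (?p \<omega>)) \<partial>P)"
  proof -
    have [measurable]: "(\<lambda>\<omega>. error (?p \<omega>) $ i) \<in> borel_measurable P" "(\<lambda>\<omega>. g (data (?p \<omega>))) \<in> borel_measurable P"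
      using measurable_compose[OF measurable_pair err] measurable_compose[OF measurable_pair gd] by auto
    show ?thesis by (simp add: nn_integral_add nn_integral_cmult error_second_moment[OF i g])
  qed
  also have "\<dots> = ennreal (\<sigma>\<^sup>2 + minv precision $$ (i, i)) * (\<integral>\<^sup>+\<omega>. g (data (?p \<omega>)) \<partial>P)"
  proof -
    \<comment> \<open>\<open>ennreal\<close> is additive on nonnegative reals only.\<close>
    have "minv precision $$ (i, i) \<ge> 0"
    proof -
      have "unit_vec n i \<bullet> (minv precision *\<^sub>v unit_vec n i) > 0"
        using pd_mat_minv_pd[OF pd_precision] i by (auto simp: pd_mat_def)
      then show ?thesis using i mult_unit_vec_index[OF pd_mat_minv(1)[OF pd_precision] i i]
        by (simp add: scalar_prod_left_unit[OF mult_mat_vec_carrier[OF pd_mat_minv(1)[OF pd_precision]]])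
    qed
    then show ?thesis by (simp add: ennreal_plus distrib_right add.commute)
  qed
  finally show ?thesis by simp
qed

end

section \<open>Graph prior and point observations\<close>

text \<open>Supplies the assumption \<open>update\<close> of \<open>rank_one_update\<close>: the
  appended row reads off \<open>x $ i\<close>, the block-diagonal noise divides it by
  \<open>s\<close>, and the transposed row sends it back along the unit vector.\<close>

lemma post_precision_append_mult_vec:
  assumes Q: "pd_mat n Q" and R: "pd_mat (length js) R" and s: "s > 0"
    and js: "set js \<subseteq> {..<n}" and i: "i < n" and x: "x \<in> carrier_vec n"
  shows "post_precision n Q (js @ [i]) (extend_cov R s) *\<^sub>v x
    = post_precision n Q js R *\<^sub>v x + (x $ i / s) \<cdot>\<^sub>v unit_vec n i"
proof -
  interpret L: linear_model n "length js" Q "obs_mat n js" R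
    using Q R obs_mat_carrier by unfold_locales auto
  interpret L': linear_model n "Suc (length js)" Q "obs_mat n (js @ [i])" "extend_cov R s"
    using Q minv_extend_cov(1)[OF R s] obs_mat_carrier[of n "js @ [i]"] by unfold_locales auto
  have Hx: "obs_mat n js *\<^sub>v x \<in> carrier_vec (length js)" by (rule mult_mat_vec_carrier[OF obs_mat_carrier x])
  have RHx: "minv R *\<^sub>v (obs_mat n js *\<^sub>v x) \<in> carrier_vec (length js)"
    by (rule mult_mat_vec_carrier[OF L.carriers(5) Hx])
  have HRHx: "transpose_mat (obs_mat n js) *\<^sub>v (minv R *\<^sub>v (obs_mat n js *\<^sub>v x)) \<in> carrier_vec n"
    by (rule mult_mat_vec_carrier[OF L.carriers(3) RHx])
  have Qx: "Q *\<^sub>v x \<in> carrier_vec n" by (rule mult_mat_vec_carrier[OF L.carriers(1) x])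
  have "post_precision n Q (js @ [i]) (extend_cov R s) *\<^sub>v x = L'.precision *\<^sub>v x"
    by (simp only: post_precision_def L'.precision_def)
  also have "\<dots> = Q *\<^sub>v x + (transpose_mat (obs_mat n js) *\<^sub>v (minv R *\<^sub>v (obs_mat n js *\<^sub>v x))
      + (x $ i / s) \<cdot>\<^sub>v unit_vec n i)"
    unfolding L'.precision_mult_vec[OF x] obs_mat_append_mult_vec[OF js i x] minv_extend_cov(2)[OF R s Hx]
      transpose_obs_mat_append_mult_vec[OF i RHx] ..
  also have "\<dots> = Q *\<^sub>v x + transpose_mat (obs_mat n js) *\<^sub>v (minv R *\<^sub>v (obs_mat n js *\<^sub>v x))
      + (x $ i / s) \<cdot>\<^sub>v unit_vec n i"
    by (rule assoc_add_vec[OF Qx HRHx, symmetric]) simp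
  also have "\<dots> = post_precision n Q js R *\<^sub>v x + (x $ i / s) \<cdot>\<^sub>v unit_vec n i"
    unfolding L.precision_mult_vec[OF x, symmetric] by (simp only: post_precision_def L.precision_def)
  finally show ?thesis .
qed

lemma observe_diff:
  assumes "x \<in> carrier_vec n" "d \<in> carrier_vec n" "h \<in> carrier_vec (length js)"
  shows "observe n js (x + d) h - obs_mat n js *\<^sub>v x = obs_mat n js *\<^sub>v d + h"
proof -
  note c = mult_mat_vec_carrier[OF obs_mat_carrier assms(1), of js] mult_mat_vec_carrier[OF obs_mat_carrier assms(2), of js]
  note dims = carrier_vecD[OF c(1)] carrier_vecD[OF c(2)] carrier_vecD[OF assms(3)]
  show ?thesis
    unfolding observe_def mult_add_distrib_mat_vec[OF obs_mat_carrier assms(1,2)]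
    using dims by (intro eq_vecI) (simp_all del: index_mult_mat_vec dim_mult_mat_vec)
qed

text \<open>\<open>F\<close> is generated by the current data alone, since everything else known at
  round k is deterministic here. The mean update holds at every sample point, the conditional
  expectation almost everywhere; integrability ensures that \<open>real_cond_exp\<close> has its
  usual meaning.\<close>

theorem proposition2:
  fixes P :: "'w measure"
    and M :: nat and C R :: "real mat" and xhat :: "real vec"
    and \<tau> lam \<sigma>y :: real and w :: "nat \<Rightarrow> real"
    and S :: "nat set" and js :: "nat list" and i :: nat
    and \<delta> \<eta>S :: "'w \<Rightarrow> real vec" and \<eta>i :: "'w \<Rightarrow> real"
  defines "Q \<equiv> graph_precision M \<tau> lam C"
    and "W \<equiv> mat_diag M w"
    and "js' \<equiv> js @ [i]"
    and "R' \<equiv> extend_cov R (\<sigma>y\<^sup>2)"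
    and "x0 \<equiv> (\<lambda>\<omega>. xhat + \<delta> \<omega>)"
  defines "yS \<equiv> (\<lambda>\<omega>. observe M js (x0 \<omega>) (\<eta>S \<omega>))"
    and "yi \<equiv> (\<lambda>\<omega>. unit_vec M i \<bullet> x0 \<omega> + \<eta>i \<omega>)"
    and "yS' \<equiv> (\<lambda>\<omega>. observe M js' (x0 \<omega>) (\<eta>S \<omega> @\<^sub>v vec 1 (\<lambda>_. \<eta>i \<omega>)))"
    and "\<Sigma> \<equiv> post_cov M Q js R"
    and "\<Sigma>' \<equiv> post_cov M Q js' R'"
  defines "m \<equiv> (\<lambda>\<omega>. post_mean M Q js R xhat (yS \<omega>))"
    and "m' \<equiv> (\<lambda>\<omega>. post_mean M Q js' R' xhat (yS' \<omega>))"
    and "F \<equiv> vimage_algebra (space P) yS (borel_vec (length js))"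
    and "U \<equiv> mtrace (W * \<Sigma>) - mtrace (W * \<Sigma>')"
    and "u \<equiv> (1 / (\<sigma>y\<^sup>2 + \<Sigma> $$ (i, i))) \<cdot>\<^sub>v (\<Sigma> *\<^sub>v unit_vec M i)"
  defines "\<nu> \<equiv> (\<lambda>\<omega>. yi \<omega> - unit_vec M i \<bullet> (xhat + m \<omega>))"
    and "\<Delta>x \<equiv> (\<lambda>\<omega>. m' \<omega> - m \<omega>)"
  assumes "prob_space P"
    and "sym_mat M C" and "\<And>a b. a < M \<Longrightarrow> b < M \<Longrightarrow> C $$ (a, b) \<ge> 0"
    and "\<tau> > 0" and "lam \<ge> 0" and "\<sigma>y > 0"
    and "xhat \<in> carrier_vec M"
    and "S \<subseteq> {..<M}" and "distinct js" and "set js = S" and "i \<in> {..<M} - S"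
    and "pd_mat (length js) R"
    and "psd_mat M W"
    and "gaussian_vec P M \<delta> (0\<^sub>v M) (minv Q)"
    and "gaussian_vec P (length js) \<eta>S (0\<^sub>v (length js)) R"
    and "distributed P lborel \<eta>i (\<lambda>t. ennreal (normal_density 0 \<sigma>y t))"
    and "indep_rv P (borel_vec M) \<delta> (borel_vec (length js)) \<eta>S"
    and "indep_rv P (borel_vec M \<Otimes>\<^sub>M borel_vec (length js)) (\<lambda>\<omega>. (\<delta> \<omega>, \<eta>S \<omega>))
           borel \<eta>i"
  shows "(\<forall>\<omega>\<in>space P. \<Delta>x \<omega> = \<nu> \<omega> \<cdot>\<^sub>v u) \<and>
    U = (\<sigma>y\<^sup>2 + \<Sigma> $$ (i, i)) * wnorm2 W u \<and>
    integrable P (\<lambda>\<omega>. wnorm2 W (\<Delta>x \<omega>)) \<and>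
    (AE \<omega> in P. real_cond_exp P F (\<lambda>\<omega>. wnorm2 W (\<Delta>x \<omega>)) \<omega> = U)"
proof -
  let ?k = "length js" and ?H = "obs_mat M js"
  have i: "i < M" and js: "set js \<subseteq> {..<M}" using assms by auto
  have s: "\<sigma>y\<^sup>2 > 0" using \<open>\<sigma>y > 0\<close> by simp
  note xh = \<open>xhat \<in> carrier_vec M\<close> and R = \<open>pd_mat ?k R\<close>
  have Q: "pd_mat M Q" unfolding Q_def by (rule pd_mat_graph_precision) fact+
  interpret G: gaussian_model M ?k Q ?H R P \<delta> \<eta>S
    by (intro gaussian_model.intro linear_model.intro gaussian_model_axioms.intro Q R obs_mat_carrier) fact+
  interpret G': linear_model M "Suc ?k" Q "obs_mat M js'" R'
    unfolding js'_def R'_def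
    using Q minv_extend_cov(1)[OF R s] obs_mat_carrier[of M "js @ [i]"] by unfold_locales auto
  have prec: "post_precision M Q js R = G.precision" "post_precision M Q js' R' = G'.precision"
    by (simp_all only: post_precision_def G.precision_def G'.precision_def)
  interpret U: rank_one_update M G.precision G'.precision i "\<sigma>y\<^sup>2"
    using G.pd_precision G'.pd_precision i s
      post_precision_append_mult_vec[OF Q R s js i, folded js'_def R'_def, unfolded prec]
    by unfold_locales auto
  have \<Sigma>: "\<Sigma> = minv G.precision" "\<Sigma>' = minv G'.precision" by (simp_all add: \<Sigma>_def \<Sigma>'_def post_cov_def prec)
  have u: "u = U.response" by (simp add: u_def U.response_def \<Sigma>)
  have trace: "U = (\<sigma>y\<^sup>2 + \<Sigma> $$ (i, i)) * wnorm2 W u"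
    unfolding U_def W_def \<Sigma> u by (rule U.mtrace_update)
  have \<delta>: "\<delta> \<in> P \<rightarrow>\<^sub>M borel_vec M" and \<eta>: "\<eta>S \<in> P \<rightarrow>\<^sub>M borel_vec ?k" and \<eta>i: "\<eta>i \<in> P \<rightarrow>\<^sub>M borel"
    using assms by (auto simp: indep_rv_def)
  let ?p = "\<lambda>\<omega>. (\<delta> \<omega>, \<eta>S \<omega>)"
  \<comment> \<open>The constant offset between the actual observations and the centred
    \<open>G.data\<close>.\<close>
  define c where "c = ?H *\<^sub>v xhat"
  have c: "c \<in> carrier_vec ?k" unfolding c_def by (rule mult_mat_vec_carrier[OF obs_mat_carrier xh])
  \<comment> \<open>This removes all posterior notation from the probabilistic part: the change of
    mean is a random scalar times a fixed vector, and the scalar is error plus fresh noise.\<close>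
  have pointwise: "\<Delta>x \<omega> = \<nu> \<omega> \<cdot>\<^sub>v u \<and> \<nu> \<omega> = G.error (?p \<omega>) $ i + \<eta>i \<omega> \<and> yS \<omega> = G.data (?p \<omega>) + c"
    if "\<omega> \<in> space P" for \<omega>
  proof -
    let ?z = "G.data (?p \<omega>)" and ?t = "\<delta> \<omega> $ i + \<eta>i \<omega>"
    note d = measurable_vec_carrier[OF \<delta> that] and h = measurable_vec_carrier[OF \<eta> that]
    note Hd = mult_mat_vec_carrier[OF obs_mat_carrier[of M js] d]
    have z: "?z \<in> carrier_vec ?k" using Hd h by (simp add: G.data_def)
    note Rz = mult_mat_vec_carrier[OF G.carriers(5) z]
    define b where "b = transpose_mat ?H *\<^sub>v (minv R *\<^sub>v ?z)"
    have b: "b \<in> carrier_vec M" unfolding b_def by (rule mult_mat_vec_carrier[OF G.carriers(3) Rz])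
    have m: "m \<omega> = minv G.precision *\<^sub>v b"
      unfolding m_def post_mean_def yS_def x0_def observe_diff[OF xh d h] prec
        G.gain_def[symmetric] b_def
      using G.gain_mult_vec[OF z] by (simp add: G.data_def)
    note mc = mult_mat_vec_carrier[OF U.carriers(3) b, folded m]
    have h': "\<eta>S \<omega> @\<^sub>v vec 1 (\<lambda>_. \<eta>i \<omega>) \<in> carrier_vec (length js')"
      using carrier_vecD[OF h] by (intro carrier_vecI) (simp add: js'_def)
    have z': "obs_mat M js' *\<^sub>v \<delta> \<omega> + (\<eta>S \<omega> @\<^sub>v vec 1 (\<lambda>_. \<eta>i \<omega>)) = ?z @\<^sub>v vec 1 (\<lambda>_. ?t)"
      unfolding js'_def obs_mat_append_mult_vec[OF js i d] G.data_def fst_conv snd_conv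
      using carrier_vecD[OF Hd] carrier_vecD[OF h]
      by (intro eq_vecI) (auto simp del: index_mult_mat_vec dim_mult_mat_vec)
    have z'c: "?z @\<^sub>v vec 1 (\<lambda>_. ?t) \<in> carrier_vec (Suc ?k)"
      using carrier_vecD[OF z] by (intro carrier_vecI) simp
    have "m' \<omega> = minv G'.precision *\<^sub>v (transpose_mat (obs_mat M js') *\<^sub>v (minv R' *\<^sub>v (?z @\<^sub>v vec 1 (\<lambda>_. ?t))))"
      unfolding m'_def post_mean_def yS'_def x0_def observe_diff[OF xh d h'] z' prec
        G'.gain_def[symmetric] by (rule G'.gain_mult_vec[OF z'c])
    \<comment> \<open>The old right-hand side \<open>b\<close> reappears with one extra term from
      the centred new measurement, which is the shape solved by \<open>minv_update\<close>.\<close>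
    also have "\<dots> = minv G'.precision *\<^sub>v (b + (?t / \<sigma>y\<^sup>2) \<cdot>\<^sub>v unit_vec M i)"
      unfolding js'_def R'_def minv_extend_cov(2)[OF R s z] transpose_obs_mat_append_mult_vec[OF i Rz] b_def ..
    also have "\<dots> = m \<omega> + (?t - m \<omega> $ i) \<cdot>\<^sub>v u"
      unfolding m u by (rule U.minv_update[OF b])
    finally have m': "m' \<omega> = m \<omega> + (?t - m \<omega> $ i) \<cdot>\<^sub>v u" .
    have \<nu>: "\<nu> \<omega> = ?t - m \<omega> $ i"
      using xh d mc i by (simp add: \<nu>_def yi_def x0_def scalar_prod_left_unit[where n = M])
    have error: "G.error (?p \<omega>) = \<delta> \<omega> - m \<omega>"
      by (simp only: G.error_def fst_conv m b_def G.gain_mult_vec[OF z])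
    have "\<Delta>x \<omega> = \<nu> \<omega> \<cdot>\<^sub>v u"
      unfolding \<Delta>x_def m' \<nu> using carrier_vecD[OF mc] U.dims(5) by (intro eq_vecI) (auto simp: u)
    moreover have "\<nu> \<omega> = G.error (?p \<omega>) $ i + \<eta>i \<omega>"
      unfolding \<nu> error using carrier_vecD[OF mc] i by simp
    moreover have "yS \<omega> = ?z + c"
      unfolding yS_def x0_def observe_def mult_add_distrib_mat_vec[OF obs_mat_carrier xh d] G.data_def c_def fst_conv snd_conv
      using carrier_vecD[OF Hd] carrier_vecD[OF h] carrier_vecD[OF c, unfolded c_def]
      by (intro eq_vecI) (auto simp del: index_mult_mat_vec dim_mult_mat_vec)
    ultimately show ?thesis by simp
  qed
  have shift: "(\<lambda>z. z + c) \<in> borel_vec ?k \<rightarrow>\<^sub>M borel_vec ?k"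
    using c by (intro measurable_add_vec) auto
  have yS: "yS \<in> P \<rightarrow>\<^sub>M borel_vec ?k"
    using measurable_compose[OF measurable_compose[OF G.measurable_pair G.measurable_data] shift]
    by (rule measurable_cong[THEN iffD1, rotated]) (simp add: pointwise)
  have sub: "subalgebra P F"
    unfolding subalgebra_def F_def using sets_image_in_sets[OF refl yS] by simp
  let ?X = "\<lambda>\<omega>. (G.error (?p \<omega>) $ i + \<eta>i \<omega>)\<^sup>2" and ?v = "\<sigma>y\<^sup>2 + \<Sigma> $$ (i, i)"
  have X: "?X \<in> borel_measurable P"
    using measurable_borel_vec_index[OF measurable_compose[OF G.measurable_pair G.measurable_error] i] \<eta>i by measurable
  have v: "?v \<ge> 0" using U.diag_pos by (simp add: \<Sigma>)
  have eq: "(\<integral>\<^sup>+\<omega>. ennreal (?X \<omega>) * indicator A \<omega> \<partial>P) = ennreal ?v * emeasure P A" if A: "A \<in> sets F" for A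
  proof -
    have dom: "yS \<in> space P \<rightarrow> space (borel_vec ?k)" using yS by (rule measurable_space[THEN funcsetI])
    obtain B where B: "B \<in> sets (borel_vec ?k)" "A = yS -` B \<inter> space P"
      using A unfolding F_def sets_vimage_algebra2[OF dom] by blast
    \<comment> \<open>An event of \<open>F\<close> is a preimage under \<open>yS\<close>; shifting
      by \<open>c\<close> rewrites its indicator as a function of the centred data.\<close>
    define g where "g z = (indicator B (z + c) :: ennreal)" for z
    have g: "g \<in> borel_measurable (borel_vec ?k)"
      unfolding g_def using B by (intro measurable_compose[OF shift]) simp
    have gA: "g (G.data (?p \<omega>)) = indicator A \<omega>" if "\<omega> \<in> space P" for \<omega>
      using that pointwise[OF that] by (auto simp: g_def B(2) indicator_def)
    have AP: "A \<in> sets P" using A sub by (auto simp: subalgebra_def)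
    have "(\<integral>\<^sup>+\<omega>. ennreal (?X \<omega>) * indicator A \<omega> \<partial>P) = (\<integral>\<^sup>+\<omega>. ennreal (?X \<omega>) * g (G.data (?p \<omega>)) \<partial>P)"
      by (intro nn_integral_cong) (simp add: gA)
    also have "\<dots> = ennreal ?v * (\<integral>\<^sup>+\<omega>. g (G.data (?p \<omega>)) \<partial>P)"
      unfolding \<Sigma> by (rule G.innovation_second_moment[OF _ _ _ i g]) fact+
    also have "(\<integral>\<^sup>+\<omega>. g (G.data (?p \<omega>)) \<partial>P) = (\<integral>\<^sup>+\<omega>. indicator A \<omega> \<partial>P)"
      by (intro nn_integral_cong) (simp add: gA)
    also have "\<dots> = emeasure P A" using AP by simp
    finally show ?thesis .
  qed
  note ce = G.real_cond_exp_constI[OF sub X _ v eq]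
  have wn: "wnorm2 W (\<Delta>x \<omega>) = ?X \<omega> * wnorm2 W u" if "\<omega> \<in> space P" for \<omega>
    using pointwise[OF that] wnorm2_smult[of W M u] U.carriers(5) by (simp add: u W_def)
  have int: "integrable P (\<lambda>\<omega>. ?X \<omega> * wnorm2 W u)" using ce(1) by simp
  then have int': "integrable P (\<lambda>\<omega>. wnorm2 W (\<Delta>x \<omega>))"
    by (rule Bochner_Integration.integrable_cong[THEN iffD1, rotated 2]) (simp_all add: wn)
  interpret S: finite_measure_subalgebra P F by standard (rule sub)
  have "AE \<omega> in P. real_cond_exp P F (\<lambda>\<omega>. wnorm2 W (\<Delta>x \<omega>)) \<omega> = real_cond_exp P F (\<lambda>\<omega>. ?X \<omega> * wnorm2 W u) \<omega>"
    using int int' by (intro S.real_cond_exp_cong) (auto simp: wn)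
  \<comment> \<open>The squared innovation has constant conditional mean \<open>?v\<close>; the
    deterministic factor \<open>wnorm2 W u\<close> is the \<open>r\<close> of
    \<open>real_cond_exp_constI\<close>.\<close>
  moreover have "AE \<omega> in P. real_cond_exp P F (\<lambda>\<omega>. ?X \<omega> * wnorm2 W u) \<omega> = ?v * wnorm2 W u"
    using ce(2)[of "wnorm2 W u"] by simp
  ultimately have "AE \<omega> in P. real_cond_exp P F (\<lambda>\<omega>. wnorm2 W (\<Delta>x \<omega>)) \<omega> = U"
    unfolding trace by eventually_elim simp
  then show ?thesis using pointwise trace int' by blast
qed

end
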